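(* Let $H\le F$ be a subgroup, let $T$ be a geodesic spanning tree (with respect to the root $o=H$) of the Schreier graph $X=H\backslash F$, and let $\Omega\subset\partial F$ be the associated Schreier limit set. Then $\Omega$ coincides, up to a set of $\mathfrak m$-measure $0$, with the conservative part of the action of $H$ on the boundary $\partial F$ with respect to the uniform measure $\mathfrak m$.
   Context: $F$ is the free group freely generated by a finite set $\mathcal A$ with $|\mathcal A|=m\ge 2$; $\breve{\mathcal A}=\mathcal A\sqcup\mathcal A^{-1}$. Elements $g\in F$ are identified with finite freely reduced words in $\breve{\mathcal A}$, $|g|$ is the word length. $\partial F$ is the set of infinite freely reduced words in $\breve{\mathcal A}$ with the product topology; $F$ acts on it by concatenation followed by free reduction. The uniform measure $\mathfrak m$ is the Borel probability measure on $\partial F$ such that the set $C_g$ of infinite words beginning with the word $g$ has measure $\frac1{2m(2m-1)^{|g|-1}}$ for every $g\ne e$; it is quasi-invariant under $F$. Schreier graph: $X=H\backslash F$ has the cosets $Hg$ as vertices and, for each vertex $x$ and $a\in\breve{\mathcal A}$, an oriented edge from $x$ to $xa$ labelled $a$, whose reversal is the edge from $xa$ to $x$ labelled $a^{-1}$ (loops and multiple edges allowed); $o=H$ is the origin. A spanning tree $T$ is geodesic if $d_T(o,x)=d_X(o,x)$ for all vertices $x$. For every oriented edge $\mathcal E=[x,y]$ of $X$ not in $T$, let $s_{\mathcal E}\in H$ be the element read along the path in $X$ going from $o$ to $x$ in $T$, then along $[x,y]$, then from $y$ to $o$ in $T$. The set $\breve{\mathcal S}$ of all $s_{\mathcal E}$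 has the form $\mathcal S\sqcup\mathcal S^{-1}$ with $\mathcal S$ (those $s_{\mathcal E}$ for which $\mathcal E$ has label in $\mathcal A$) a free generating set of $H$. Let $\partial H$ be the set of infinite freely reduced words $\xi=s_1s_2\dots$ in $\breve{\mathcal S}$; for each such $\xi$ the limit $\sigma^\infty(\xi)=\lim_n s_1\cdots s_n\in\partial F$ (pointwise convergence of reduced words in $\breve{\mathcal A}$) exists. The Schreier limit set is $\Omega=\sigma^\infty(\partial H)$. Hopf decomposition: for a measure class preserving action of a countable group $G$ on a measure space $(\mathcal X,\mu)$, a measurable set $A$ is recurrent if (mod 0) $A\subset\bigcup_{g\ne e}gA$, and wandering if its translates $gA$, $g\in G$, are pairwise disjoint. The action is conservative if every measurable set of positive measure is recurrent, and completely dissipative if $\mathcal X$ is (mod 0) the union of translates of a wandering set. There is a (mod 0) unique decomposition of $\mathcal X$ into disjoint invariant measurable sets $\mathcal C\sqcup\mathcal D$ such that the action is conservative on $\mathcal C$ (the conservative part) and completely dissipative on $\mathcal D$ (the dissipative part). *)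

theory Defs
  imports
    "HOL-Probability.Probability"
    "HOL-Algebra.Coset"
    "Graph_Theory.Digraph_Component"
    "Graph_Theory.Shortest_Path"
begin

section \<open>The free group and its boundary\<close>

text \<open>
  The generating set is the (finite) type \<open>'a\<close>.  The letter \<open>(a, True)\<close> stands for the generator
  \<open>a\<close>, and \<open>(a, False)\<close> for its inverse.
\<close>

type_synonym 'a letter = "'a \<times> bool"

definition inv_letter :: "'a letter \<Rightarrow> 'a letter" where
  "inv_letter x = (fst x, \<not> snd x)"

definition reduced :: "'a letter list \<Rightarrow> bool" where
  "reduced w \<longleftrightarrow> successively (\<lambda>x y. y \<noteq> inv_letter x) w"

text \<open>\<open>cons_red x w\<close> is the free reduction of the word \<open>x # w\<close> for a reduced word \<open>w\<close>.\<close>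

definition cons_red :: "'a letter \<Rightarrow> 'a letter list \<Rightarrow> 'a letter list" where
  "cons_red x w = (if w \<noteq> [] \<and> hd w = inv_letter x then tl w else x # w)"

definition reduce :: "'a letter list \<Rightarrow> 'a letter list" where
  "reduce w = foldr cons_red w []"

definition free_group :: "'a letter list monoid" (\<open>\<F>\<close>) where
  "\<F> = \<lparr>carrier = {w. reduced w}, mult = (\<lambda>g h. reduce (g @ h)), one = []\<rparr>"

text \<open>
  Infinite freely reduced words over an alphabet \<open>S\<close> on which \<open>i\<close> is the formal inversion.
\<close>

definition reduced_streams :: "('b \<Rightarrow> 'b) \<Rightarrow> 'b set \<Rightarrow> 'b stream set" where
  "reduced_streams i S = {\<xi> \<in> streams S. \<forall>n. \<xi> !! Suc n \<noteq> i (\<xi> !! n)}"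

definition boundary :: "'a letter stream set" (\<open>\<partial>\<F>\<close>) where
  "\<partial>\<F> = reduced_streams inv_letter UNIV"

text \<open>\<open>scons_red x \<omega>\<close> is the free reduction of the infinite word \<open>x ## \<omega>\<close> for a reduced \<open>\<omega>\<close>.\<close>

definition scons_red :: "'a letter \<Rightarrow> 'a letter stream \<Rightarrow> 'a letter stream" where
  "scons_red x \<omega> = (if shd \<omega> = inv_letter x then stl \<omega> else x ## \<omega>)"

definition bdry_act :: "'a letter list \<Rightarrow> 'a letter stream \<Rightarrow> 'a letter stream" where
  "bdry_act g \<omega> = foldr scons_red g \<omega>"

definition cylinder :: "'a letter list \<Rightarrow> 'a letter stream set" where
  "cylinder g = {\<omega> \<in> \<partial>\<F>. stake (length g) \<omega> = g}"

definition boundary_topology :: "'a letter stream topology" where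
  "boundary_topology =
     pullback_topology \<partial>\<F> snth (product_topology (\<lambda>_. discrete_topology UNIV) UNIV)"

text \<open>This characterises the measure \<open>m\<close> uniquely.\<close>

definition is_uniform_boundary_measure :: "'a::finite letter stream measure \<Rightarrow> bool" where
  "is_uniform_boundary_measure m \<longleftrightarrow>
     prob_space m \<and>
     sets m = sets (sigma \<partial>\<F> {U. openin boundary_topology U}) \<and>
     (\<forall>g \<in> carrier \<F> - {\<one>\<^bsub>\<F>\<^esub>}.
        measure m (cylinder g) =
          1 / (2 * real CARD('a) * (2 * real CARD('a) - 1) ^ (length g - 1)))"


section \<open>The Schreier graph and its geodesic spanning trees\<close>

text \<open>The arc \<open>(x, a)\<close> is the oriented edge labelled \<open>a\<close> from the coset \<open>x\<close> to the coset \<open>xa\<close>.\<close>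

type_synonym 'a coset = "'a letter list set"
type_synonym 'a arc = "'a coset \<times> 'a letter"

definition schreier_graph :: "'a letter list set \<Rightarrow> ('a coset, 'a arc) pre_digraph" where
  "schreier_graph H =
     \<lparr>verts = rcosets\<^bsub>\<F>\<^esub> H,
      arcs = (rcosets\<^bsub>\<F>\<^esub> H) \<times> UNIV,
      tail = fst,
      head = (\<lambda>(x, a). x #>\<^bsub>\<F>\<^esub> [a])\<rparr>"

definition arc_rev :: "'a arc \<Rightarrow> 'a arc" where
  "arc_rev = (\<lambda>(x, a). (x #>\<^bsub>\<F>\<^esub> [a], inv_letter a))"

text \<open>
  Undirected trees, where an undirected edge is a pair of mutually reverse arcs \<open>e\<close>, \<open>r e\<close>.
  The library's \<^const>\<open>Digraph_Component.tree\<close> forbids all directed cycles, hence also the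
  backtracking walks \<open>[e, r e]\<close>, so no graph with two mutually reverse non-loop arcs satisfies it.
\<close>

definition undirected_tree :: "('v, 'e) pre_digraph \<Rightarrow> ('e \<Rightarrow> 'e) \<Rightarrow> bool" where
  "undirected_tree T r \<longleftrightarrow>
     Digraph_Component.connected T \<and>
     (\<forall>e \<in> arcs T. r e \<in> arcs T) \<and>
     (\<forall>p. pre_digraph.cycle T p \<longrightarrow> (\<exists>e \<in> arcs T. p = [e, r e]))"

definition graph_dist :: "('v, 'e) pre_digraph \<Rightarrow> 'v \<Rightarrow> 'v \<Rightarrow> ereal" where
  "graph_dist G = wf_digraph.\<mu> G (\<lambda>_. 1)"

text \<open>The origin of the Schreier graph is the coset \<open>H\<close> itself.\<close>

definition geodesic_spanning_tree ::
    "'a letter list set \<Rightarrow> ('a coset, 'a arc) pre_digraph \<Rightarrow> bool" where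
  "geodesic_spanning_tree H T \<longleftrightarrow>
     spanning T (schreier_graph H) \<and>
     undirected_tree T arc_rev \<and>
     (\<forall>x \<in> verts (schreier_graph H). graph_dist T H x = graph_dist (schreier_graph H) H x)"


section \<open>The Schreier limit set\<close>

text \<open>The unique path without repeated vertices from \<open>u\<close> to \<open>v\<close> in the tree \<open>T\<close>.\<close>

definition tree_path :: "('v, 'e) pre_digraph \<Rightarrow> 'v \<Rightarrow> 'v \<Rightarrow> 'e list" where
  "tree_path T u v = (THE p. pre_digraph.apath T u p v)"

definition edge_element ::
    "'a letter list set \<Rightarrow> ('a coset, 'a arc) pre_digraph \<Rightarrow> 'a arc \<Rightarrow> 'a letter list" where
  "edge_element H T e =
     reduce (map snd (tree_path T H (tail (schreier_graph H) e) @ [e]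
                      @ tree_path T (head (schreier_graph H) e) H))"

text \<open>The symmetrised generating set of \<open>H\<close>, i.e. the generators together with their inverses.\<close>

definition sym_generators ::
    "'a letter list set \<Rightarrow> ('a coset, 'a arc) pre_digraph \<Rightarrow> 'a letter list set" where
  "sym_generators H T = edge_element H T ` (arcs (schreier_graph H) - arcs T)"

definition subgroup_boundary ::
    "'a letter list set \<Rightarrow> ('a coset, 'a arc) pre_digraph \<Rightarrow> 'a letter list stream set" where
  "subgroup_boundary H T = reduced_streams (\<lambda>s. inv\<^bsub>\<F>\<^esub> s) (sym_generators H T)"

text \<open>
  Pointwise convergence of finite words to an infinite one.  As \<open>stake k \<omega>\<close> has length \<open>k\<close>, the
  equation below includes that \<open>w n\<close> has length at least \<open>k\<close>.
\<close>

definition words_tendsto :: "(nat \<Rightarrow> 'b list) \<Rightarrow> 'b stream \<Rightarrow> bool" where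
  "words_tendsto w \<omega> \<longleftrightarrow> (\<forall>k. \<forall>\<^sub>F n in sequentially. take k (w n) = stake k \<omega>)"

definition sigma_infty :: "'a letter list stream \<Rightarrow> 'a letter stream" where
  "sigma_infty \<xi> =
     (THE \<omega>. \<omega> \<in> \<partial>\<F> \<and> words_tendsto (\<lambda>n. foldr (\<otimes>\<^bsub>\<F>\<^esub>) (stake n \<xi>) \<one>\<^bsub>\<F>\<^esub>) \<omega>)"

definition schreier_limit_set ::
    "'a letter list set \<Rightarrow> ('a coset, 'a arc) pre_digraph \<Rightarrow> 'a letter stream set" where
  "schreier_limit_set H T = sigma_infty ` subgroup_boundary H T"


section \<open>The Hopf decomposition\<close>

text \<open>
  Here \<open>\<phi> g\<close> is the action of \<open>g\<close> on the space of \<open>M\<close>; the notions are meant for measure class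
  preserving actions of countable groups.
\<close>

definition recurrent_set ::
    "('g, 'r) monoid_scheme \<Rightarrow> ('g \<Rightarrow> 'x \<Rightarrow> 'x) \<Rightarrow> 'x measure \<Rightarrow> 'x set \<Rightarrow> bool" where
  "recurrent_set G \<phi> M A \<longleftrightarrow>
     A \<in> sets M \<and> (AE x in M. x \<in> A \<longrightarrow> x \<in> (\<Union>g \<in> carrier G - {\<one>\<^bsub>G\<^esub>}. \<phi> g ` A))"

definition wandering_set ::
    "('g, 'r) monoid_scheme \<Rightarrow> ('g \<Rightarrow> 'x \<Rightarrow> 'x) \<Rightarrow> 'x measure \<Rightarrow> 'x set \<Rightarrow> bool" where
  "wandering_set G \<phi> M A \<longleftrightarrow>
     A \<in> sets M \<and> disjoint_family_on (\<lambda>g. \<phi> g ` A) (carrier G)"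

definition conservative_action ::
    "('g, 'r) monoid_scheme \<Rightarrow> ('g \<Rightarrow> 'x \<Rightarrow> 'x) \<Rightarrow> 'x measure \<Rightarrow> bool" where
  "conservative_action G \<phi> M \<longleftrightarrow> (\<forall>A \<in> sets M. emeasure M A > 0 \<longrightarrow> recurrent_set G \<phi> M A)"

definition completely_dissipative_action ::
    "('g, 'r) monoid_scheme \<Rightarrow> ('g \<Rightarrow> 'x \<Rightarrow> 'x) \<Rightarrow> 'x measure \<Rightarrow> bool" where
  "completely_dissipative_action G \<phi> M \<longleftrightarrow>
     (\<exists>A. wandering_set G \<phi> M A \<and> (AE x in M. x \<in> (\<Union>g \<in> carrier G. \<phi> g ` A)))"

definition invariant_set ::
    "('g, 'r) monoid_scheme \<Rightarrow> ('g \<Rightarrow> 'x \<Rightarrow> 'x) \<Rightarrow> 'x set \<Rightarrow> bool" where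
  "invariant_set G \<phi> A \<longleftrightarrow> (\<forall>g \<in> carrier G. \<phi> g ` A = A)"

definition hopf_decomposition ::
    "('g, 'r) monoid_scheme \<Rightarrow> ('g \<Rightarrow> 'x \<Rightarrow> 'x) \<Rightarrow> 'x measure \<Rightarrow> 'x set \<Rightarrow> 'x set \<Rightarrow> bool" where
  "hopf_decomposition G \<phi> M C D \<longleftrightarrow>
     C \<in> sets M \<and> D \<in> sets M \<and> C \<inter> D = {} \<and> C \<union> D = space M \<and>
     invariant_set G \<phi> C \<and> invariant_set G \<phi> D \<and>
     conservative_action G \<phi> (restrict_space M C) \<and>
     completely_dissipative_action G \<phi> (restrict_space M D)"

text \<open>
  The conservative part is only determined modulo null sets, so being one is a predicate.
\<close>

definition is_conservative_part ::
    "('g, 'r) monoid_scheme \<Rightarrow> ('g \<Rightarrow> 'x \<Rightarrow> 'x) \<Rightarrow> 'x measure \<Rightarrow> 'x set \<Rightarrow> bool" where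
  "is_conservative_part G \<phi> M C \<longleftrightarrow> (\<exists>D. hopf_decomposition G \<phi> M C D)"

end

theory Submission
  imports Defs
begin

text \<open>
  Every \<open>\<omega> \<in> \<partial>\<F>\<close> labels a path from the origin in the Schreier graph.  The limit set consists of those
  \<open>\<omega>\<close> whose path leaves the tree \<open>T\<close> infinitely often: reading off the edges outside \<open>T\<close> gives the
  expansion of \<open>\<omega>\<close> in the Schreier generators.  The remaining \<open>\<omega>\<close> are the translates of rays that stay
  in \<open>T\<close>, and these rays form a wandering set.

  Let \<open>W\<close> be a wandering subset of the limit set.  An element \<open>h\<close> expands the measure at \<open>\<omega>\<close> by
  \<open>q\<close> to the power \<open>-\<beta>(h, \<omega>)\<close>, where \<open>\<beta>\<close> is the Busemann cocycle and \<open>q = 2 * CARD('a) - 1\<close>; as the translates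
  of \<open>W\<close> have total measure at most 1, \<open>W\<close> is null unless \<open>\<beta>(_, \<omega>)\<close> is bounded below on \<open>H\<close> for
  a non-null set of \<open>\<omega> \<in> W\<close>.  Moving \<open>\<omega>\<close> to where the minimum is attained, we get \<open>\<beta>(_, \<omega>) \<ge> 0\<close>, which
  means that the path of \<open>\<omega>\<close> is geodesic.  But whenever a geodesic path crosses an edge outside \<open>T\<close>,
  the last edge of the tree path to the vertex it reaches leads back towards the origin.
  So one of the \<open>q\<close> possible next letters is excluded, and almost surely this happens only finitely often.
\<close>

section \<open>Free reduction\<close>

lemma inv_letter_inv_letter [simp]: "inv_letter (inv_letter x) = x"
  by (simp add: inv_letter_def)

lemma inv_letter_neq [simp]: "inv_letter x \<noteq> x" "x \<noteq> inv_letter x"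
  by (auto simp: inv_letter_def prod_eq_iff)

lemma inv_letter_eq_iff [simp]: "inv_letter x = inv_letter y \<longleftrightarrow> x = y"
  by (metis inv_letter_inv_letter)

definition inv_word :: "'a letter list \<Rightarrow> 'a letter list" where
  "inv_word w = rev (map inv_letter w)"

lemma inv_word_simps [simp]:
  "inv_word [] = []"
  "inv_word (a # w) = inv_word w @ [inv_letter a]"
  "inv_word (u @ v) = inv_word v @ inv_word u"
  "inv_word (inv_word w) = w"
  "length (inv_word w) = length w"
  by (simp_all add: inv_word_def rev_map comp_def)

lemma reduced_Nil [simp]: "reduced []"
  by (simp add: reduced_def)

lemma reduced_Cons: "reduced (a # w) \<longleftrightarrow> reduced w \<and> (w \<noteq> [] \<longrightarrow> hd w \<noteq> inv_letter a)"
  by (cases w) (auto simp: reduced_def)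

lemma reduced_singleton [simp]: "reduced [a]"
  by (simp add: reduced_Cons)

lemma reduced_append:
  "reduced (u @ v) \<longleftrightarrow>
     reduced u \<and> reduced v \<and> (u \<noteq> [] \<longrightarrow> v \<noteq> [] \<longrightarrow> hd v \<noteq> inv_letter (last u))"
  by (auto simp: reduced_def successively_append_iff)

lemma reduced_join: "reduced (u @ [a]) \<Longrightarrow> reduced (a # v) \<Longrightarrow> reduced (u @ a # v)"
  by (simp add: reduced_append reduced_Cons)

lemma reduced_inv_word: "reduced w \<Longrightarrow> reduced (inv_word w)"
  by (induction w) (auto simp: reduced_append reduced_Cons inv_word_def last_rev hd_map)

lemma reduced_nth:
  "reduced w \<longleftrightarrow> (\<forall>i. Suc i < length w \<longrightarrow> w ! Suc i \<noteq> inv_letter (w ! i))"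
  by (auto simp: reduced_def successively_conv_nth)

lemma reduced_cons_red: "reduced w \<Longrightarrow> reduced (cons_red a w)"
  by (cases w) (auto simp: cons_red_def reduced_Cons)

lemma cons_red_reduced: "reduced (a # w) \<Longrightarrow> cons_red a w = a # w"
  by (auto simp: cons_red_def reduced_Cons)

text \<open>Left multiplication by a letter permutes the reduced words, with inverse given by the
  inverse letter. This is van der Waerden's device; it replaces a confluence argument for free
  reduction.\<close>

lemma cons_red_cancel:
  assumes "reduced w"
  shows "cons_red (inv_letter a) (cons_red a w) = w" "cons_red a (cons_red (inv_letter a) w) = w"
  using assms by (cases w; cases "tl w"; force simp: cons_red_def reduced_Cons)+

lemma reduced_foldr_cons_red: "reduced w \<Longrightarrow> reduced (foldr cons_red u w)"
  by (induction u) (auto intro: reduced_cons_red)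

lemma reduced_reduce [simp]: "reduced (reduce w)"
  by (simp add: reduce_def reduced_foldr_cons_red)

lemma reduce_Nil [simp]: "reduce [] = []"
  by (simp add: reduce_def)

lemma reduce_Cons: "reduce (a # w) = cons_red a (reduce w)"
  by (simp add: reduce_def)

lemma reduce_reduced: "reduced w \<Longrightarrow> reduce w = w"
  by (induction w) (auto simp: reduce_Cons cons_red_reduced reduced_Cons)

text \<open>A cancelling pair of letters acts trivially on reduced words by
  \<open>cons_red_cancel\<close>, so only the reduction of the acting word matters. Associativity of
  the free group rests on this.\<close>

lemma foldr_cons_red_reduce:
  assumes "reduced w"
  shows "foldr cons_red (reduce u) w = foldr cons_red u w"
proof (induction u)
  case (Cons a u)
  have "foldr cons_red (cons_red a v) w = cons_red a (foldr cons_red v w)" for v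
    using cons_red_cancel(2)[OF reduced_foldr_cons_red[OF assms, of "tl v"], of a]
    by (cases v) (auto simp: cons_red_def)
  then show ?case using Cons by (simp add: reduce_Cons)
qed simp

lemma reduce_append: "reduce (u @ v) = foldr cons_red u (reduce v)"
  by (simp add: reduce_def)

lemma reduce_append_reduce [simp]:
  "reduce (reduce u @ v) = reduce (u @ v)"
  "reduce (u @ reduce v) = reduce (u @ v)"
  by (simp_all add: reduce_append foldr_cons_red_reduce reduce_reduced)

lemma reduce_append_cong: "reduce u = reduce u' \<Longrightarrow> reduce v = reduce v' \<Longrightarrow> reduce (u @ v) = reduce (u' @ v')"
  by (metis reduce_append_reduce)

lemma reduce_inv_word [simp]:
  "reduce (inv_word w @ w) = []" "reduce (w @ inv_word w) = []"
proof -
  show *: "reduce (inv_word w @ w) = []" for w :: "'a letter list"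
  proof (induction w)
    case (Cons a w)
    have "reduce ([inv_letter a] @ a # w) = reduce w"
      by (simp add: reduce_Cons cons_red_cancel)
    then have "reduce (inv_word w @ [inv_letter a] @ a # w) = reduce (inv_word w @ w)"
      by (metis reduce_append_reduce(2))
    then show ?case using Cons by simp
  qed simp
  from *[of "inv_word w"] show "reduce (w @ inv_word w) = []" by simp
qed

lemma reduce_eq_iff: "reduce (inv_word u @ v) = [] \<longleftrightarrow> reduce u = reduce v"
proof
  assume "reduce (inv_word u @ v) = []"
  then have "reduce (u @ (inv_word u @ v)) = reduce (u @ [])"
    by (metis reduce_append_reduce(2) reduce_Nil)
  moreover have "reduce ((u @ inv_word u) @ v) = reduce ([] @ v)"
    by (metis reduce_append_reduce(1) reduce_inv_word(2))
  ultimately show "reduce u = reduce v" by simp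
next
  assume "reduce u = reduce v"
  then show "reduce (inv_word u @ v) = []"
    by (metis reduce_append_reduce(2) reduce_inv_word(1))
qed

lemma carrier_free_group: "carrier \<F> = {w. reduced w}"
  and mult_free_group: "g \<otimes>\<^bsub>\<F>\<^esub> h = reduce (g @ h)"
  and one_free_group: "\<one>\<^bsub>\<F>\<^esub> = []"
  by (simp_all add: free_group_def)

lemmas free_group_simps = carrier_free_group mult_free_group one_free_group

lemma group_free_group: "group \<F>"
proof (rule groupI)
  fix x :: "'a letter list" assume "x \<in> carrier \<F>"
  then show "\<exists>y\<in>carrier \<F>. y \<otimes>\<^bsub>\<F>\<^esub> x = \<one>\<^bsub>\<F>\<^esub>"
    by (intro bexI[of _ "inv_word x"]) (auto simp: free_group_simps reduced_inv_word)
qed (auto simp: free_group_simps reduce_reduced)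

lemma inv_free_group: "reduced g \<Longrightarrow> inv\<^bsub>\<F>\<^esub> g = inv_word g"
  by (rule group.inv_equality[OF group_free_group]) (auto simp: free_group_simps reduced_inv_word)

lemma foldr_mult_free_group:
  "foldr (\<otimes>\<^bsub>\<F>\<^esub>) ws \<one>\<^bsub>\<F>\<^esub> = reduce (concat ws)"
  by (induction ws) (auto simp: free_group_simps)

section \<open>The action on the boundary\<close>

lemma boundary_iff: "\<omega> \<in> \<partial>\<F> \<longleftrightarrow> (\<forall>n. \<omega> !! Suc n \<noteq> inv_letter (\<omega> !! n))"
  by (simp add: boundary_def reduced_streams_def)

lemma boundary_SCons: "a ## \<omega> \<in> \<partial>\<F> \<longleftrightarrow> \<omega> \<in> \<partial>\<F> \<and> shd \<omega> \<noteq> inv_letter a"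
proof -
  have "(\<forall>n. P n) \<longleftrightarrow> P 0 \<and> (\<forall>n. P (Suc n))" for P :: "nat \<Rightarrow> bool"
    by (metis nat.exhaust)
  from this[of "\<lambda>n. (a ## \<omega>) !! Suc n \<noteq> inv_letter ((a ## \<omega>) !! n)"]
  show ?thesis by (auto simp: boundary_iff)
qed

lemma boundary_stl: "\<omega> \<in> \<partial>\<F> \<Longrightarrow> stl \<omega> \<in> \<partial>\<F>"
  by (metis boundary_SCons stream.collapse)

lemma boundary_shd_stl: "\<omega> \<in> \<partial>\<F> \<Longrightarrow> shd (stl \<omega>) \<noteq> inv_letter (shd \<omega>)"
  by (metis boundary_SCons stream.collapse)

lemma boundary_sdrop: "\<omega> \<in> \<partial>\<F> \<Longrightarrow> sdrop n \<omega> \<in> \<partial>\<F>"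
  by (induction n arbitrary: \<omega>) (auto intro: boundary_stl)

lemma boundary_reduced_stake: "\<omega> \<in> \<partial>\<F> \<longleftrightarrow> (\<forall>n. reduced (stake n \<omega>))"
proof safe
  fix n assume "\<omega> \<in> \<partial>\<F>"
  then show "reduced (stake n \<omega>)" by (auto simp: boundary_iff reduced_nth simp del: stake.simps)
next
  assume *: "\<forall>n. reduced (stake n \<omega>)"
  show "\<omega> \<in> \<partial>\<F>" unfolding boundary_iff
  proof
    fix n
    have "reduced (stake (Suc (Suc n)) \<omega>)" using * by blast
    then have "stake (Suc (Suc n)) \<omega> ! Suc n \<noteq> inv_letter (stake (Suc (Suc n)) \<omega> ! n)"
      unfolding reduced_nth length_stake by blast
    then show "\<omega> !! Suc n \<noteq> inv_letter (\<omega> !! n)" by (simp del: stake.simps)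
  qed
qed

lemma reduced_stake: "\<omega> \<in> \<partial>\<F> \<Longrightarrow> reduced (stake n \<omega>)"
  using boundary_reduced_stake by blast

lemma scons_red_boundary: "\<omega> \<in> \<partial>\<F> \<Longrightarrow> scons_red a \<omega> \<in> \<partial>\<F>"
  by (auto simp: scons_red_def boundary_SCons boundary_stl)

lemma scons_red_cancel:
  assumes "\<omega> \<in> \<partial>\<F>"
  shows "scons_red (inv_letter a) (scons_red a \<omega>) = \<omega>"
        "scons_red a (scons_red (inv_letter a) \<omega>) = \<omega>"
  using boundary_shd_stl[OF assms] by (auto simp: scons_red_def) (metis stream.collapse)+

lemma bdry_act_Nil [simp]: "bdry_act [] \<omega> = \<omega>"
  and bdry_act_Cons: "bdry_act (a # g) \<omega> = scons_red a (bdry_act g \<omega>)"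
  and bdry_act_append: "bdry_act (g @ h) \<omega> = bdry_act g (bdry_act h \<omega>)"
  by (simp_all add: bdry_act_def)

lemma bdry_act_boundary: "\<omega> \<in> \<partial>\<F> \<Longrightarrow> bdry_act g \<omega> \<in> \<partial>\<F>"
  by (induction g) (auto simp: bdry_act_Cons scons_red_boundary)

lemma bdry_act_cons_red:
  assumes "\<omega> \<in> \<partial>\<F>"
  shows "bdry_act (cons_red a g) \<omega> = scons_red a (bdry_act g \<omega>)"
  using scons_red_cancel(2)[OF bdry_act_boundary[OF assms, of "tl g"], of a]
  by (cases g) (auto simp: cons_red_def bdry_act_Cons)

lemma bdry_act_reduce: "\<omega> \<in> \<partial>\<F> \<Longrightarrow> bdry_act (reduce g) \<omega> = bdry_act g \<omega>"
  by (induction g) (auto simp: reduce_Cons bdry_act_cons_red bdry_act_Cons)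

lemma bdry_act_inv_word:
  assumes "\<omega> \<in> \<partial>\<F>"
  shows "bdry_act (inv_word g) (bdry_act g \<omega>) = \<omega>" "bdry_act g (bdry_act (inv_word g) \<omega>) = \<omega>"
  using bdry_act_reduce[OF assms, of "inv_word g @ g"] bdry_act_reduce[OF assms, of "g @ inv_word g"]
  by (simp_all add: bdry_act_append)

lemma inj_on_bdry_act: "inj_on (bdry_act g) \<partial>\<F>"
  by (rule inj_on_inverseI[where g = "bdry_act (inv_word g)"]) (rule bdry_act_inv_word(1))

lemma bdry_act_image:
  assumes "B \<subseteq> \<partial>\<F>"
  shows "bdry_act g ` B = {\<omega> \<in> \<partial>\<F>. bdry_act (inv_word g) \<omega> \<in> B}"
proof safe
  fix \<omega> assume "\<omega> \<in> B"
  with assms show "bdry_act g \<omega> \<in> \<partial>\<F>" "bdry_act (inv_word g) (bdry_act g \<omega>) \<in> B"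
    by (auto simp: bdry_act_boundary bdry_act_inv_word subsetD)
next
  fix \<omega> assume "\<omega> \<in> \<partial>\<F>" "bdry_act (inv_word g) \<omega> \<in> B"
  then show "\<omega> \<in> bdry_act g ` B" by (metis bdry_act_inv_word(2) imageI)
qed

lemma bdry_act_shift_sdrop:
  assumes "length g \<le> n"
  shows "bdry_act g \<omega> = foldr cons_red g (stake n \<omega>) @- sdrop n \<omega> \<and>
         length (foldr cons_red g (stake n \<omega>)) + length g \<ge> n"
  using assms
proof (induction g)
  case Nil
  then show ?case by (simp add: stake_sdrop)
next
  case (Cons a g)
  define w where "w = foldr cons_red g (stake n \<omega>)"
  \<comment> \<open>The prefix is nonempty because here \<open>n\<close> is at least
    \<open>Suc (length g)\<close>, so the letter \<open>a\<close> acts inside it.\<close>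
  from Cons have *: "bdry_act g \<omega> = w @- sdrop n \<omega>" "length w + length g \<ge> n" "w \<noteq> []"
    by (auto simp: w_def)
  have "scons_red a (w @- sdrop n \<omega>) = cons_red a w @- sdrop n \<omega>"
    using *(3) by (cases w) (auto simp: scons_red_def cons_red_def)
  moreover have "length (cons_red a w) + Suc (length g) \<ge> n"
    using *(2) by (auto simp: cons_red_def)
  ultimately show ?case by (simp add: bdry_act_Cons * w_def[symmetric])
qed

lemma bdry_act_eventually:
  assumes "\<omega> \<in> \<partial>\<F>" "length g \<le> n"
  shows "bdry_act g \<omega> = reduce (g @ stake n \<omega>) @- sdrop n \<omega>"
  using bdry_act_shift_sdrop[OF assms(2), of \<omega>] reduced_stake[OF assms(1), of n]
  by (simp add: reduce_append reduce_reduced)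

lemma bdry_act_inv_stake:
  "bdry_act (inv_word (stake n \<omega>)) \<omega> = sdrop n \<omega>"
  by (induction n arbitrary: \<omega>) (auto simp: bdry_act_append bdry_act_Cons scons_red_def)

section \<open>The Busemann cocycle\<close>

text \<open>For reduced \<open>g\<close>, \<open>busemann g \<omega>\<close> is the limit of \<open>|g \<cdot> \<omega>\<^sub>n| - n\<close>,
  where \<open>\<omega>\<^sub>n\<close> is the prefix of \<open>\<omega>\<close> of length \<open>n\<close>.\<close>

primrec busemann :: "'a letter list \<Rightarrow> 'a letter stream \<Rightarrow> int" where
  "busemann [] \<omega> = 0"
| "busemann (a # g) \<omega> = busemann g \<omega> + (if shd (bdry_act g \<omega>) = inv_letter a then -1 else 1)"

lemma busemann_append: "busemann (g @ h) \<omega> = busemann g (bdry_act h \<omega>) + busemann h \<omega>"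
  by (induction g) (auto simp: bdry_act_append)

lemma busemann_le_length: "busemann g \<omega> \<le> int (length g)"
  by (induction g) auto

text \<open>A cancelling pair of letters contributes \<open>1\<close> and \<open>-1\<close>, because
  points of the boundary are reduced. Hence the cocycle depends only on the group element.\<close>

lemma busemann_cons_red:
  assumes "\<omega> \<in> \<partial>\<F>"
  shows "busemann (cons_red a g) \<omega> = busemann (a # g) \<omega>"
proof (cases "g \<noteq> [] \<and> hd g = inv_letter a")
  case True
  then obtain g' where g: "g = inv_letter a # g'" by (cases g) auto
  define \<eta> where "\<eta> = bdry_act g' \<omega>"
  have "\<eta> \<in> \<partial>\<F>" using assms by (simp add: \<eta>_def bdry_act_boundary)
  then show ?thesis using boundary_shd_stl[of \<eta>]
    by (auto simp: g cons_red_def bdry_act_Cons scons_red_def \<eta>_def[symmetric])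
qed (auto simp: cons_red_def)

lemma busemann_reduce: "\<omega> \<in> \<partial>\<F> \<Longrightarrow> busemann (reduce g) \<omega> = busemann g \<omega>"
  by (induction g) (auto simp: reduce_Cons busemann_cons_red bdry_act_reduce)

lemma busemann_inv_stake: "busemann (inv_word (stake n \<omega>)) \<omega> = - int n"
  by (induction n arbitrary: \<omega>) (auto simp: bdry_act_Cons scons_red_def busemann_append)

section \<open>The uniform measure\<close>

text \<open>A basic open box restricts finitely many coordinates, so around each of its points it
  contains the cylinder of a long enough prefix. Conversely, a cylinder is the trace of such a
  box.\<close>

lemma openin_boundary_topology_iff:
  fixes U :: "'a letter stream set"
  shows
  "openin boundary_topology U \<longleftrightarrow> U \<subseteq> \<partial>\<F> \<and> (\<forall>\<omega>\<in>U. \<exists>n. cylinder (stake n \<omega>) \<subseteq> U)"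
proof
  let ?P = "product_topology (\<lambda>_. discrete_topology UNIV) UNIV :: (nat \<Rightarrow> 'a letter) topology"
  assume "openin boundary_topology U"
  then obtain V where V: "openin ?P V" and U: "U = snth -` V \<inter> \<partial>\<F>"
    unfolding boundary_topology_def openin_pullback_topology by blast
  have "\<exists>n. cylinder (stake n \<omega>) \<subseteq> U" if "\<omega> \<in> U" for \<omega>
  proof -
    have "snth \<omega> \<in> V" using U that by auto
    then obtain B where B: "finite {i. B i \<noteq> UNIV}" "snth \<omega> \<in> Pi\<^sub>E UNIV B" "Pi\<^sub>E UNIV B \<subseteq> V"
      using V unfolding openin_product_topology_alt by auto
    \<comment> \<open>Inserting \<open>0\<close> keeps \<open>Max\<close> meaningful when no
      coordinate is restricted.\<close>
    define n where "n = Suc (Max (insert 0 {i. B i \<noteq> UNIV}))"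
    have n: "i < n" if "B i \<noteq> UNIV" for i
      using that B(1) by (auto simp: n_def less_Suc_eq_le)
    have "\<eta> \<in> U" if "\<eta> \<in> cylinder (stake n \<omega>)" for \<eta>
    proof -
      have "stake n \<eta> = stake n \<omega>" "\<eta> \<in> \<partial>\<F>" using that by (auto simp: cylinder_def)
      then have eq: "\<eta> !! i = \<omega> !! i" if "i < n" for i using that by (metis stake_nth)
      have "\<eta> !! i \<in> B i" for i
        using n[of i] eq[of i] B(2) by (cases "B i = UNIV") (auto simp: PiE_iff)
      then have "snth \<eta> \<in> Pi\<^sub>E UNIV B" by auto
      then show ?thesis using B(3) U \<open>\<eta> \<in> \<partial>\<F>\<close> by auto
    qed
    then show ?thesis by blast
  qed
  then show "U \<subseteq> \<partial>\<F> \<and> (\<forall>\<omega>\<in>U. \<exists>n. cylinder (stake n \<omega>) \<subseteq> U)" using U by blast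
next
  let ?P = "product_topology (\<lambda>_. discrete_topology UNIV) UNIV :: (nat \<Rightarrow> 'a letter) topology"
  assume U: "U \<subseteq> \<partial>\<F> \<and> (\<forall>\<omega>\<in>U. \<exists>n. cylinder (stake n \<omega>) \<subseteq> U)"
  define V where "V = (\<Union>w\<in>{w. cylinder w \<subseteq> U}. {f. \<forall>i<length w. f i = w ! i})"
  have "openin ?P {f. \<forall>i<length w. f i = w ! i}" for w :: "'a letter list"
  proof -
    have "{f. \<forall>i<length w. f i = w ! i} = Pi\<^sub>E UNIV (\<lambda>i. if i < length w then {w ! i} else UNIV)"
      by (auto simp: PiE_iff extensional_def split: if_splits)
    moreover have "openin ?P (Pi\<^sub>E UNIV (\<lambda>i. if i < length w then {w ! i} else UNIV))"
      by (subst openin_PiE_gen) (auto intro: finite_subset[of _ "{..<length w}"])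
    ultimately show ?thesis by simp
  qed
  then have "openin ?P V" unfolding V_def by blast
  moreover have "U = snth -` V \<inter> \<partial>\<F>"
  proof (rule Set.set_eqI, rule iffI)
    fix \<omega> assume "\<omega> \<in> U"
    then obtain n where "cylinder (stake n \<omega>) \<subseteq> U" using U by blast
    then have "snth \<omega> \<in> V" unfolding V_def by (intro UN_I[of "stake n \<omega>"]) auto
    then show "\<omega> \<in> snth -` V \<inter> \<partial>\<F>" using U \<open>\<omega> \<in> U\<close> by auto
  next
    fix \<omega> assume "\<omega> \<in> snth -` V \<inter> \<partial>\<F>"
    then obtain w where "cylinder w \<subseteq> U" "\<forall>i<length w. \<omega> !! i = w ! i" "\<omega> \<in> \<partial>\<F>"
      unfolding V_def by auto
    moreover from this(2) have "stake (length w) \<omega> = w" by (intro nth_equalityI) auto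
    ultimately show "\<omega> \<in> U" by (auto simp: cylinder_def)
  qed
  ultimately show "openin boundary_topology U"
    unfolding boundary_topology_def openin_pullback_topology by blast
qed

section \<open>Cylinders as generators of the Borel sets\<close>

lemma cylinder_subset: "cylinder u \<subseteq> \<partial>\<F>"
  by (auto simp: cylinder_def)

lemma cylinder_Nil [simp]: "cylinder [] = \<partial>\<F>"
  by (auto simp: cylinder_def)

lemma cylinder_not_reduced: "\<not> reduced u \<Longrightarrow> cylinder u = {}"
  by (auto simp: cylinder_def) (metis reduced_stake)

lemma cylinder_append_subset: "cylinder (u @ v) \<subseteq> cylinder u"
proof
  fix \<omega> assume "\<omega> \<in> cylinder (u @ v)"
  then have "\<omega> \<in> \<partial>\<F>" "take (length u) (stake (length (u @ v)) \<omega>) = u"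
    by (auto simp: cylinder_def)
  then show "\<omega> \<in> cylinder u" by (simp add: cylinder_def take_stake)
qed

lemma cylinder_nested:
  assumes "\<omega> \<in> cylinder u" "\<omega> \<in> cylinder v" "length u \<le> length v"
  shows "cylinder v \<subseteq> cylinder u" "\<exists>w. v = u @ w"
proof -
  have "v = stake (length v) \<omega>" "u = stake (length u) \<omega>" using assms by (auto simp: cylinder_def)
  then have "v = u @ drop (length u) v" using assms(3)
    by (metis append_take_drop_id min.absorb1 take_stake)
  then show "\<exists>w. v = u @ w" "cylinder v \<subseteq> cylinder u" by (blast, metis cylinder_append_subset)
qed

text \<open>Two cylinders are nested or disjoint, by comparison of prefixes.\<close>

lemma Int_stable_cylinder: "Int_stable (range cylinder)"
proof (rule Int_stableI, safe)
  fix u v :: "'a letter list"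
  have "cylinder u \<inter> cylinder v \<in> {cylinder u, cylinder v, {}}"
    using cylinder_nested(1)[of _ u v] cylinder_nested(1)[of _ v u]
    by (cases "length u \<le> length v") auto
  \<comment> \<open>The empty set has to be a cylinder too; it is the one over a word that is not
    reduced.\<close>
  moreover have "{} = cylinder [x, inv_letter x]" for x :: "'a letter"
    by (subst cylinder_not_reduced) (auto simp: reduced_Cons)
  ultimately show "cylinder u \<inter> cylinder v \<in> range cylinder"
    by (metis insertE rangeI singletonD)
qed

text \<open>There are only countably many words, so every open set is a countable union of
  cylinders. Measures can therefore be compared on cylinders.\<close>

lemma sigma_sets_boundary:
  "sigma_sets \<partial>\<F> {U. openin boundary_topology U} =
   sigma_sets \<partial>\<F> (range (cylinder :: 'a::finite letter list \<Rightarrow> _))" (is "?A = ?B")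
proof
  have "U \<in> ?B" if "openin boundary_topology U" for U :: "'a letter stream set"
  proof -
    have U: "U \<subseteq> \<partial>\<F>" "\<forall>\<omega>\<in>U. \<exists>n. cylinder (stake n \<omega>) \<subseteq> U"
      using that by (auto simp: openin_boundary_topology_iff)
    have "U = (\<Union>w\<in>{w. cylinder w \<subseteq> U}. cylinder w)"
    proof safe
      fix \<omega> assume "\<omega> \<in> U"
      then obtain n where "cylinder (stake n \<omega>) \<subseteq> U" using U by blast
      moreover have "\<omega> \<in> cylinder (stake n \<omega>)" using \<open>\<omega> \<in> U\<close> U by (auto simp: cylinder_def)
      ultimately show "\<omega> \<in> (\<Union>w\<in>{w. cylinder w \<subseteq> U}. cylinder w)" by blast
    qed auto
    also have "\<dots> \<in> ?B"
      by (rule sigma_sets_UNION) auto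
    finally show ?thesis .
  qed
  then show "?A \<subseteq> ?B" by (intro sigma_sets_mono) auto
  have "openin boundary_topology (cylinder w)" for w :: "'a letter list"
    unfolding openin_boundary_topology_iff
    by (intro conjI ballI exI[of _ "length w"]) (auto simp: cylinder_def)
  then show "?B \<subseteq> ?A" by (intro sigma_sets_mono) auto
qed

section \<open>Measurability and the measure of cylinders\<close>

locale uniform_boundary =
  fixes m :: "'a::finite letter stream measure"
  assumes uniform: "is_uniform_boundary_measure m"
begin

sublocale prob_space m
  using uniform by (simp add: is_uniform_boundary_measure_def)

text \<open>The number of letters that may follow a given letter in a reduced word, i.e. the
  branching number of the Cayley tree.\<close>

definition q :: real where "q = 2 * real CARD('a) - 1"

lemma q_ge_1: "q \<ge> 1"
  using zero_less_card_finite[where 'a='a] by (simp add: q_def)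

lemma sets_eq: "sets m = sigma_sets \<partial>\<F> (range cylinder)"
proof -
  have "sets m = sets (sigma \<partial>\<F> {U. openin boundary_topology U})"
    using uniform by (simp add: is_uniform_boundary_measure_def)
  also have "\<dots> = sigma_sets \<partial>\<F> {U. openin boundary_topology U}"
    by (rule sets_measure_of) (auto simp: openin_boundary_topology_iff)
  finally show ?thesis by (simp add: sigma_sets_boundary)
qed

lemma space_eq: "space m = \<partial>\<F>"
proof -
  have "sets m = sets (sigma \<partial>\<F> {U. openin boundary_topology U})"
    using uniform by (simp add: is_uniform_boundary_measure_def)
  then have "space m = space (sigma \<partial>\<F> {U. openin boundary_topology U})"
    by (rule sets_eq_imp_space_eq)
  also have "\<dots> = \<partial>\<F>" by (rule space_measure_of) (auto simp: openin_boundary_topology_iff)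
  finally show ?thesis .
qed

lemma cylinder_sets [measurable]: "cylinder u \<in> sets m"
  unfolding sets_eq by (rule sigma_sets.Basic) auto

lemma boundary_sets [measurable]: "\<partial>\<F> \<in> sets m"
  using cylinder_sets[of "[]"] by simp

lemma stake_sets: "{\<omega> \<in> \<partial>\<F>. P (stake n \<omega>)} \<in> sets m"
proof -
  have "{\<omega> \<in> \<partial>\<F>. P (stake n \<omega>)} = (\<Union>u\<in>{u. length u = n \<and> P u}. cylinder u)"
    by (auto simp: cylinder_def)
  also have "\<dots> \<in> sets m" by (rule sets.countable_UN') auto
  finally show ?thesis .
qed

lemma measure_cylinder:
  assumes "reduced (a # u)"
  shows "measure m (cylinder (a # u)) = 1 / ((q + 1) * q ^ length u)"
  using uniform assms by (auto simp: is_uniform_boundary_measure_def free_group_simps q_def)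

text \<open>The first letter of a word has \<open>q + 1\<close> choices and only the later ones have
  \<open>q\<close>, hence the nonempty \<open>u\<close>.\<close>

lemma measure_cylinder_snoc:
  assumes "reduced (u @ [a])" "u \<noteq> []"
  shows "measure m (cylinder (u @ [a])) = measure m (cylinder u) / q"
proof -
  from assms obtain b v where u: "u = b # v" by (cases u) auto
  have r: "reduced (b # v @ [a])" "reduced (b # v)"
    using assms by (auto simp: u reduced_append simp flip: append_Cons)
  show ?thesis using measure_cylinder[OF r(1)] measure_cylinder[OF r(2)]
    by (simp add: u mult_ac)
qed

lemma measurable_scons_red [measurable]: "scons_red a \<in> measurable m m"
proof (rule measurable_sigma_sets[OF sets_eq])
  fix A :: "'a letter stream set" assume "A \<in> range cylinder"
  then obtain u where A: "A = cylinder u" by blast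
  define n where "n = length u"
  \<comment> \<open>A cancellation consumes one letter, so the first \<open>n\<close> letters of the
    image are determined by the first \<open>Suc n\<close> letters of
    \<open>\<omega>\<close>.\<close>
  have eq: "stake n (scons_red a \<omega>) = take n (cons_red a (stake (Suc n) \<omega>))" for \<omega>
  proof -
    define w where "w = stake (Suc n) \<omega>"
    have w: "w \<noteq> []" "hd w = shd \<omega>" "tl w = stake n (stl \<omega>)" by (simp_all add: w_def)
    have "take k w = stake k \<omega>" if "k \<le> n" for k
      using that unfolding w_def by (simp only: take_stake) (simp add: min_def)
    then show ?thesis unfolding w_def[symmetric] using w
      by (cases n) (auto simp: scons_red_def cons_red_def take_stake)
  qed
  have "scons_red a -` A \<inter> space m = {\<omega> \<in> \<partial>\<F>. take n (cons_red a (stake (Suc n) \<omega>)) = u}"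
    by (auto simp: A cylinder_def space_eq scons_red_boundary eq[unfolded n_def] n_def simp del: stake.simps)
  also have "\<dots> \<in> sets m" by (rule stake_sets)
  finally show "scons_red a -` A \<inter> space m \<in> sets m" .
qed (use cylinder_subset in \<open>auto simp: space_eq scons_red_boundary\<close>)

lemma measurable_bdry_act [measurable]: "bdry_act g \<in> measurable m m"
proof (induction g)
  case (Cons a g)
  have "bdry_act (a # g) = scons_red a \<circ> bdry_act g" by (auto simp: bdry_act_Cons fun_eq_iff)
  then show ?case using measurable_comp[OF Cons measurable_scons_red[of a]] by metis
next
  case Nil
  have "bdry_act [] = id" by auto
  then show ?case by simp
qed

lemma bdry_act_image_sets [measurable]:
  assumes "B \<in> sets m"
  shows "bdry_act g ` B \<in> sets m"
proof -
  have "B \<subseteq> \<partial>\<F>" using sets.sets_into_space[OF assms] by (simp add: space_eq)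
  then have "bdry_act g ` B = bdry_act (inv_word g) -` B \<inter> space m"
    by (auto simp: bdry_act_image space_eq)
  also have "\<dots> \<in> sets m" using assms by measurable
  finally show ?thesis .
qed

lemma sets_subset: "B \<in> sets m \<Longrightarrow> B \<subseteq> \<partial>\<F>"
  using sets.sets_into_space space_eq by blast

lemma shd_sets: "{\<omega> \<in> \<partial>\<F>. P (shd \<omega>)} \<in> sets m"
  using stake_sets[of "\<lambda>u. P (hd u)" 1] by simp

text \<open>The predicate \<open>P\<close> is arbitrary so that the induction can shift it by one in
  either direction.\<close>

lemma busemann_sets: "{\<omega> \<in> \<partial>\<F>. P (busemann g \<omega>)} \<in> sets m"
proof (induction g arbitrary: P)
  case (Cons a g)
  let ?S = "bdry_act g -` {\<omega> \<in> \<partial>\<F>. shd \<omega> = inv_letter a} \<inter> space m"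
  have "?S \<in> sets m" using shd_sets[of "\<lambda>b. b = inv_letter a"] by measurable
  moreover have "{\<omega> \<in> \<partial>\<F>. P (busemann (a # g) \<omega>)} =
     (?S \<inter> {\<omega> \<in> \<partial>\<F>. P (busemann g \<omega> - 1)}) \<union> ({\<omega> \<in> \<partial>\<F>. P (busemann g \<omega> + 1)} - ?S)"
    by (auto simp: space_eq bdry_act_boundary)
  ultimately show ?case using Cons[of "\<lambda>x. P (x - 1)"] Cons[of "\<lambda>x. P (x + 1)"] by simp
next
  case Nil
  then show ?case using stake_sets[of "\<lambda>_. P 0" 0] by simp
qed

text \<open>Two measures are compared on cylinders: \<open>M\<close> is \<open>q\<close> times
  \<open>m\<close> on \<open>cylinder [inv_letter a]\<close>, and \<open>N\<close> is the image of
  \<open>m\<close> off \<open>cylinder [a]\<close> under prefixing \<open>inv_letter a\<close>.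
  Evaluating both at \<open>B\<close> gives the claim, as \<open>N\<close> measures \<open>B\<close>
  by its image under \<open>scons_red a\<close>.\<close>

lemma emeasure_scons_red_cancel:
  assumes B: "B \<in> sets m" "B \<subseteq> cylinder [inv_letter a]"
  shows "emeasure m (scons_red a ` B) = ennreal q * emeasure m B"
proof -
  let ?b = "inv_letter a"
  define M where "M = density m (\<lambda>\<omega>. ennreal q * indicator (cylinder [?b]) \<omega>)"
  define N where "N = distr (density m (indicator (\<partial>\<F> - cylinder [a]))) m (scons_red ?b)"
  define R where "R X = {\<omega> \<in> \<partial>\<F> - cylinder [a]. scons_red ?b \<omega> \<in> X}" for X
  have R_sets: "R X \<in> sets m" if "X \<in> sets m" for X
  proof -
    have "R X = scons_red ?b -` X \<inter> space m - cylinder [a]" by (auto simp: R_def space_eq)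
    then show ?thesis using that by simp
  qed
  have M: "emeasure M X = ennreal q * emeasure m (cylinder [?b] \<inter> X)" if "X \<in> sets m" for X
  proof -
    have "emeasure M X = (\<integral>\<^sup>+\<omega>. ennreal q * indicator (cylinder [?b] \<inter> X) \<omega> \<partial>m)"
      using that unfolding M_def
      by (subst emeasure_density) (auto intro!: nn_integral_cong simp: indicator_def)
    then show ?thesis using that by (simp add: nn_integral_cmult_indicator)
  qed
  have N: "emeasure N X = emeasure m (R X)" if "X \<in> sets m" for X
  proof -
    have "emeasure N X = emeasure (density m (indicator (\<partial>\<F> - cylinder [a]))) (scons_red ?b -` X \<inter> space m)"
      using that unfolding N_def by (subst emeasure_distr) auto
    also have "\<dots> = (\<integral>\<^sup>+\<omega>. indicator (\<partial>\<F> - cylinder [a]) \<omega> *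
        indicator (scons_red ?b -` X \<inter> space m) \<omega> \<partial>m)"
      using that by (subst emeasure_density) auto
    also have "\<dots> = (\<integral>\<^sup>+\<omega>. indicator (R X) \<omega> \<partial>m)"
      by (rule nn_integral_cong) (simp only: indicator_def R_def space_eq, auto)
    finally show ?thesis using R_sets[OF that] by simp
  qed
  have "M = N"
  proof (rule measure_eqI_generator_eq[OF Int_stable_cylinder, where \<Omega> = "\<partial>\<F>" and A = "\<lambda>_. \<partial>\<F>"])
    fix X :: "'a letter stream set" assume "X \<in> range cylinder"
    then obtain u where X: "X = cylinder u" by blast
    have Ca: "measure m (cylinder [c]) = 1 / (q + 1)" for c
      using measure_cylinder[of c "[]"] by simp
    \<comment> \<open>Both sides equal \<open>q / (q + 1)\<close>.\<close>
    have base: "ennreal q * emeasure m (cylinder [?b]) = emeasure m (\<partial>\<F> - cylinder [a])"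
    proof -
      have "measure m (\<partial>\<F> - cylinder [a]) = 1 - 1 / (q + 1)"
        using prob_compl[of "cylinder [a]"] Ca[of a] by (simp add: space_eq)
      also have "\<dots> = q * (1 / (q + 1))" using q_ge_1 by (simp add: field_simps)
      finally show ?thesis using q_ge_1
        by (simp add: emeasure_eq_measure Ca ennreal_mult[symmetric])
    qed
    have nocancel: "scons_red ?b \<omega> = ?b ## \<omega>" if "\<omega> \<in> \<partial>\<F> - cylinder [a]" for \<omega>
      using that by (auto simp: cylinder_def scons_red_def)
    \<comment> \<open>The empty word and \<open>[?b]\<close> carry the whole mass, and words with
      another first letter carry none. A longer reduced word loses its first letter, which
      multiplies the measure of its cylinder by \<open>q\<close>.\<close>
    consider "\<not> reduced u" | "u = [] \<or> u = [?b]" | c v where "u = c # v" "c \<noteq> ?b"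
      | v where "u = ?b # v" "v \<noteq> []" "reduced u"
      by (metis list.exhaust)
    then show "emeasure M X = emeasure N X"
    proof cases
      case 1
      then show ?thesis by (simp add: X M N cylinder_not_reduced R_def)
    next
      case 2
      have "R X = \<partial>\<F> - cylinder [a]"
        using 2 nocancel scons_red_boundary[of _ ?b] by (auto simp: R_def X cylinder_def)
      moreover have "cylinder [?b] \<inter> X = cylinder [?b]" using 2 cylinder_subset[of "[?b]"] by (auto simp: X)
      ultimately show ?thesis using base by (simp add: M N X)
    next
      case 3
      then have "cylinder [?b] \<inter> X = {}" "R X = {}"
        using nocancel by (auto simp: X R_def cylinder_def)
      then show ?thesis by (simp add: M N X)
    next
      case 4
      then have r: "reduced v" "hd v \<noteq> a" by (auto simp: reduced_Cons)
      have "R X = cylinder v"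
      proof -
        have "\<omega> \<notin> cylinder [a]" if "\<omega> \<in> cylinder v" for \<omega>
        proof -
          have "stake (length v) \<omega> = v" using that by (simp add: cylinder_def)
          then have "shd \<omega> = hd v" using 4(2) by (cases v) auto
          then show ?thesis using r by (auto simp: cylinder_def)
        qed
        moreover have "scons_red ?b \<omega> \<in> X \<longleftrightarrow> \<omega> \<in> cylinder v" if "\<omega> \<in> \<partial>\<F> - cylinder [a]" for \<omega>
          using that nocancel[OF that] scons_red_boundary[of \<omega> ?b] by (auto simp: X 4(1) cylinder_def)
        ultimately show ?thesis using cylinder_subset[of v] by (auto simp: R_def)
      qed
      moreover have "cylinder [?b] \<inter> X = X"
        using cylinder_append_subset[of "[?b]" v] by (auto simp: X 4)
      moreover have "q * measure m X = measure m (cylinder v)"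
      proof -
        obtain c w where v: "v = c # w" using 4(2) by (cases v) auto
        show ?thesis
          using 4(3) r(1) q_ge_1 measure_cylinder[of ?b v] measure_cylinder[of c w]
          by (simp add: X 4(1) v mult_ac)
      qed
      ultimately show ?thesis using q_ge_1
        by (simp add: M N X emeasure_eq_measure ennreal_mult[symmetric])
    qed
  next
    show "sets M = sigma_sets \<partial>\<F> (range cylinder)" "sets N = sigma_sets \<partial>\<F> (range cylinder)"
      by (simp_all add: M_def N_def sets_eq)
    show "emeasure M \<partial>\<F> \<noteq> \<infinity>"
      by (simp add: M emeasure_eq_measure ennreal_mult_eq_top_iff)
    show "range (\<lambda>_. \<partial>\<F>) \<subseteq> range cylinder" using cylinder_Nil by blast
  qed (use cylinder_subset in auto)
  moreover have "R B = scons_red a ` B"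
  proof safe
    fix \<omega> assume "\<omega> \<in> R B"
    then show "\<omega> \<in> scons_red a ` B"
      using scons_red_cancel(2)[of \<omega> a] by (auto simp: R_def) (metis imageI)
  next
    fix \<omega> assume "\<omega> \<in> B"
    then have "\<omega> \<in> \<partial>\<F>" "shd \<omega> = ?b" using B(2) by (auto simp: cylinder_def)
    then show "scons_red a \<omega> \<in> R B"
      using \<open>\<omega> \<in> B\<close> boundary_shd_stl[of \<omega>] scons_red_cancel(1)[of \<omega> a]
      by (auto simp: R_def boundary_stl scons_red_def cylinder_def)
  qed
  moreover have "cylinder [?b] \<inter> B = B" using B by blast
  ultimately show ?thesis using M[OF B(1)] N[OF B(1)] by simp
qed

text \<open>On the image of \<open>B\<close> the inverse letter cancels and leads back to
  \<open>B\<close>, so the cancelling case applies there.\<close>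

lemma emeasure_scons_red_extend:
  assumes B: "B \<in> sets m" "B \<inter> cylinder [inv_letter a] = {}"
  shows "ennreal q * emeasure m (scons_red a ` B) = emeasure m B"
proof -
  have sub: "B \<subseteq> \<partial>\<F>" using sets_subset[OF B(1)] .
  have "scons_red a ` B \<in> sets m" using bdry_act_image_sets[OF B(1), of "[a]"] by (simp add: bdry_act_Cons)
  moreover have "scons_red a ` B \<subseteq> cylinder [a]"
    using B sub by (force simp: scons_red_def cylinder_def boundary_SCons)
  moreover have "scons_red (inv_letter a) ` scons_red a ` B = B"
    using sub by (force simp: image_image scons_red_cancel(1))
  ultimately show ?thesis using emeasure_scons_red_cancel[of "scons_red a ` B" "inv_letter a"] by simp
qed

text \<open>This identifies the Radon-Nikodym derivative of the action, one level set of the cocycle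
  at a time. \<open>B\<close> and \<open>j\<close> vary in the induction because a level set splits
  according to whether the next letter cancels.\<close>

lemma emeasure_bdry_act:
  assumes "B \<in> sets m" "\<And>\<omega>. \<omega> \<in> B \<Longrightarrow> busemann g \<omega> = j"
  shows "emeasure m (bdry_act g ` B) = ennreal (q powi (- j)) * emeasure m B"
  using assms
proof (induction g arbitrary: B j)
  case Nil
  then show ?case by (cases "B = {}") auto
next
  case (Cons a g)
  define B1 where "B1 = B \<inter> {\<omega> \<in> \<partial>\<F>. shd (bdry_act g \<omega>) = inv_letter a}"
  define B2 where "B2 = B - B1"
  have S: "{\<omega> \<in> \<partial>\<F>. shd (bdry_act g \<omega>) = inv_letter a} \<in> sets m"
  proof -
    have "bdry_act g -` {\<omega> \<in> \<partial>\<F>. shd \<omega> = inv_letter a} \<inter> space m \<in> sets m"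
      using shd_sets[of "\<lambda>b. b = inv_letter a"] by measurable
    also have "bdry_act g -` {\<omega> \<in> \<partial>\<F>. shd \<omega> = inv_letter a} \<inter> space m =
        {\<omega> \<in> \<partial>\<F>. shd (bdry_act g \<omega>) = inv_letter a}"
      by (auto simp: space_eq bdry_act_boundary)
    finally show ?thesis .
  qed
  have sets: "B1 \<in> sets m" "B2 \<in> sets m" using S Cons.prems by (auto simp: B1_def B2_def)
  have sub: "B \<subseteq> \<partial>\<F>" using sets_subset[OF Cons.prems(1)] .
  \<comment> \<open>On \<open>B1\<close> the letter \<open>a\<close> cancels and lowers the cocycle
    by one, so \<open>g\<close> alone has the value \<open>j + 1\<close> there; on \<open>B2\<close>
    it has the value \<open>j - 1\<close>.\<close>
  have j: "busemann g \<omega> = j + 1" if "\<omega> \<in> B1" for \<omega> using that Cons.prems(2)[of \<omega>] by (auto simp: B1_def)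
  have j': "busemann g \<omega> = j - 1" if "\<omega> \<in> B2" for \<omega>
    using that Cons.prems(2)[of \<omega>] sub by (auto simp: B1_def B2_def split: if_splits)
  have "q powi (- j) = q * q powi (- (j + 1))"
    using q_ge_1 by (simp add: power_int_diff power_int_add power_int_minus field_simps)
  have 1: "emeasure m (bdry_act (a # g) ` B1) = ennreal (q powi (- j)) * emeasure m B1"
  proof -
    have "emeasure m (scons_red a ` bdry_act g ` B1) = ennreal q * emeasure m (bdry_act g ` B1)"
      by (intro emeasure_scons_red_cancel bdry_act_image_sets sets)
        (auto simp: B1_def cylinder_def bdry_act_boundary)
    also have "\<dots> = ennreal q * ennreal (q powi (- (j + 1))) * emeasure m B1"
      using Cons.IH[OF sets(1) j] by (simp add: mult.assoc)
    also have "ennreal q * ennreal (q powi (- (j + 1))) = ennreal (q powi (- j))"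
      using q_ge_1 by (simp add: ennreal_mult[symmetric] power_int_add power_int_diff power_int_minus field_simps)
    finally show ?thesis by (simp add: image_image bdry_act_Cons)
  qed
  have 2: "emeasure m (bdry_act (a # g) ` B2) = ennreal (q powi (- j)) * emeasure m B2"
  proof -
    have "ennreal q * emeasure m (scons_red a ` bdry_act g ` B2) = emeasure m (bdry_act g ` B2)"
      using sub by (intro emeasure_scons_red_extend bdry_act_image_sets sets)
        (auto simp: B1_def B2_def cylinder_def)
    also have "\<dots> = ennreal (q powi (- (j - 1))) * emeasure m B2"
      using Cons.IH[OF sets(2) j'] .
    also have "ennreal (q powi (- (j - 1))) = ennreal q * ennreal (q powi (- j))"
      using q_ge_1 by (simp add: ennreal_mult[symmetric] power_int_add power_int_diff power_int_minus field_simps)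
    finally have "ennreal q * emeasure m (scons_red a ` bdry_act g ` B2) =
        ennreal q * (ennreal (q powi (- j)) * emeasure m B2)" by (simp add: mult.assoc)
    then show ?thesis using q_ge_1
      by (subst (asm) ennreal_mult_cancel_left) (auto simp: image_image bdry_act_Cons)
  qed
  have "bdry_act (a # g) ` B1 \<inter> bdry_act (a # g) ` B2 = {}"
  proof -
    have "inj_on (bdry_act (a # g)) \<partial>\<F>" by (rule inj_on_bdry_act)
    moreover have "B1 \<inter> B2 = {}" "B1 \<subseteq> \<partial>\<F>" "B2 \<subseteq> \<partial>\<F>" using sub by (auto simp: B1_def B2_def)
    ultimately show ?thesis using inj_on_image_Int by (metis image_empty)
  qed
  then have "emeasure m (bdry_act (a # g) ` (B1 \<union> B2)) =
      emeasure m (bdry_act (a # g) ` B1) + emeasure m (bdry_act (a # g) ` B2)"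
    unfolding image_Un by (intro plus_emeasure[symmetric] bdry_act_image_sets sets)
  also have "\<dots> = ennreal (q powi (- j)) * (emeasure m B1 + emeasure m B2)"
    by (simp add: 1 2 distrib_left)
  also have "emeasure m B1 + emeasure m B2 = emeasure m (B1 \<union> B2)"
    by (intro plus_emeasure sets) (auto simp: B2_def)
  also have "B1 \<union> B2 = B" by (auto simp: B1_def B2_def)
  finally show ?case .
qed

text \<open>Quasi-invariance: the set is cut into countably many level sets of the cocycle, on each
  of which the measure is scaled by a finite factor.\<close>

lemma bdry_act_null_sets:
  assumes "B \<in> null_sets m"
  shows "bdry_act g ` B \<in> null_sets m"
proof -
  have B: "B \<in> sets m" "emeasure m B = 0" using assms by auto
  define L where "L j = B \<inter> {\<omega> \<in> \<partial>\<F>. busemann g \<omega> = j}" for j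
  have L: "L j \<in> sets m" for j using B busemann_sets[of "\<lambda>i. i = j" g] by (auto simp: L_def)
  have "emeasure m (L j) = 0" for j
    using emeasure_mono[of "L j" B m] B by (auto simp: L_def)
  then have "bdry_act g ` L j \<in> null_sets m" for j
    using emeasure_bdry_act[OF L, of j g j] bdry_act_image_sets[OF L] by (auto simp: L_def null_sets_def)
  then have "(\<Union>j. bdry_act g ` L j) \<in> null_sets m" by (rule null_sets_UN)
  also have "(\<Union>j. bdry_act g ` L j) = bdry_act g ` B" using sets_subset[OF B(1)] by (force simp: L_def)
  finally show ?thesis .
qed

text \<open>The level sets of \<open>busemann g\<close> in \<open>B\<close> are scaled by exact
  factors \<open>q ^ j\<close> with \<open>j \<ge> k\<close>, and their images stay disjoint by
  injectivity.\<close>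

lemma emeasure_bdry_act_expand:
  assumes B: "B \<in> sets m" "\<And>\<omega>. \<omega> \<in> B \<Longrightarrow> busemann g \<omega> \<le> - int k"
  shows "ennreal (q ^ k) * emeasure m B \<le> emeasure m (bdry_act g ` B)"
proof -
  define L where "L j = B \<inter> {\<omega> \<in> \<partial>\<F>. busemann g \<omega> = - int j}" for j
  have sub: "B \<subseteq> \<partial>\<F>" using sets_subset[OF B(1)] .
  have L: "L j \<in> sets m" for j using B busemann_sets[of "\<lambda>i. i = - int j" g] by (auto simp: L_def)
  have inj: "inj_on (bdry_act g) \<partial>\<F>" by (rule inj_on_bdry_act)
  have U: "(\<Union>j. L j) = B"
  proof
    show "B \<subseteq> (\<Union>j. L j)"
    proof
      fix \<omega> assume "\<omega> \<in> B"
      \<comment> \<open>No information is lost by \<open>nat\<close>, since the hypothesis makes the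
        cocycle nonpositive on \<open>B\<close>.\<close>
      then have "\<omega> \<in> L (nat (- busemann g \<omega>))" using B(2)[of \<omega>] sub by (auto simp: L_def)
      then show "\<omega> \<in> (\<Union>j. L j)" by blast
    qed
  qed (auto simp: L_def)
  have d: "disjoint_family L" by (auto simp: disjoint_family_on_def L_def)
  have d': "disjoint_family (\<lambda>j. bdry_act g ` L j)"
    unfolding disjoint_family_on_def
  proof (intro ballI impI)
    fix i j :: nat assume "i \<noteq> j"
    then have "L i \<inter> L j = {}" "L i \<subseteq> \<partial>\<F>" "L j \<subseteq> \<partial>\<F>" by (auto simp: L_def)
    then show "bdry_act g ` L i \<inter> bdry_act g ` L j = {}"
      using inj_on_image_Int[OF inj] by (metis image_empty)
  qed
  have "ennreal (q ^ k) * emeasure m (L j) \<le> emeasure m (bdry_act g ` L j)" for j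
  proof (cases "L j = {}")
    case False
    then have "k \<le> j" using B(2) by (fastforce simp: L_def)
    then have "q ^ k \<le> q powi (- (- int j))" using q_ge_1 by (simp add: power_increasing)
    then show ?thesis
      using emeasure_bdry_act[OF L, of j g "- int j"]
      by (auto simp: L_def intro!: mult_right_mono ennreal_leI)
  qed auto
  then have "(\<Sum>j. ennreal (q ^ k) * emeasure m (L j)) \<le> (\<Sum>j. emeasure m (bdry_act g ` L j))"
    by (intro suminf_le) auto
  moreover have "(\<Sum>j. emeasure m (bdry_act g ` L j)) = emeasure m (\<Union>j. bdry_act g ` L j)"
    using bdry_act_image_sets[OF L] by (intro suminf_emeasure d') auto
  moreover have "(\<Sum>j. ennreal (q ^ k) * emeasure m (L j)) = ennreal (q ^ k) * emeasure m (\<Union>j. L j)"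
    using L suminf_emeasure[OF _ d] by (simp add: ennreal_suminf_cmult image_subset_iff)
  ultimately show ?thesis by (simp only: U image_UN[symmetric])
qed

end

section \<open>Walks in a labelled graph with a spanning tree\<close>

text \<open>Walks are represented by their labels only: as \<open>st\<close> is a function, a start
  vertex and the labels determine all arcs.\<close>

primrec walk_in :: "('v \<Rightarrow> 'a letter \<Rightarrow> 'v) \<Rightarrow> ('v \<times> 'a letter) set \<Rightarrow> 'v \<Rightarrow> 'a letter list \<Rightarrow> bool" where
  "walk_in st E x [] \<longleftrightarrow> True"
| "walk_in st E x (a # w) \<longleftrightarrow> (x, a) \<in> E \<and> walk_in st E (st x a) w"

lemma walk_in_append: "walk_in st E x (u @ v) \<longleftrightarrow> walk_in st E x u \<and> walk_in st E (foldl st x u) v"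
  by (induction u arbitrary: x) auto

text \<open>If the exits came at different positions, the earlier exit arc would be an arc of the
  longer walk, which lies in \<open>E\<close>.\<close>

lemma first_exit_unique:
  assumes "walk_in st E x p" "(foldl st x p, a) \<notin> E"
    and "walk_in st E x p'" "(foldl st x p', a') \<notin> E"
    and "p @ a # t = p' @ a' # t'"
  shows "p = p' \<and> a = a' \<and> t = t'"
  using assms
proof (induction p arbitrary: x p')
  case Nil
  then show ?case by (cases p') auto
next
  case (Cons b p)
  then show ?case by (cases p') auto
qed

section \<open>Limits of finite words\<close>

lemma words_tendsto_unique:
  assumes "words_tendsto w \<omega>" "words_tendsto w \<eta>"
  shows "\<omega> = \<eta>"
proof -
  have "\<omega> !! k = \<eta> !! k" for k
  proof -
    have "\<forall>\<^sub>F n in sequentially. take (Suc k) (w n) = stake (Suc k) \<omega> \<and> take (Suc k) (w n) = stake (Suc k) \<eta>"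
      using assms unfolding words_tendsto_def by (intro eventually_conj) blast+
    then obtain n where "take (Suc k) (w n) = stake (Suc k) \<omega>" "take (Suc k) (w n) = stake (Suc k) \<eta>"
      by (auto simp: eventually_sequentially simp del: stake.simps)
    then have "stake (Suc k) \<omega> ! k = stake (Suc k) \<eta> ! k" by simp
    then show ?thesis by (simp del: stake.simps)
  qed
  then have "snth \<omega> = snth \<eta>" by blast
  then show ?thesis by (metis stream_smap_nats)
qed

lemma prefix_chain_limit:
  fixes W :: "nat \<Rightarrow> 'b list"
  assumes step: "\<And>n. \<exists>t. W (Suc n) = W n @ t" and len: "\<And>n. n \<le> length (W n)"
  obtains \<omega> where "\<And>n. stake (length (W n)) \<omega> = W n"
proof
  \<comment> \<open>Letter \<open>i\<close> is read off from \<open>W (Suc i)\<close>, the first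
    word that \<open>len\<close> guarantees to have a position \<open>i\<close>.\<close>
  define \<omega> where "\<omega> = smap (\<lambda>i. W (Suc i) ! i) nats"
  have mono: "\<exists>t. W k = W n @ t" if "n \<le> k" for n k
    using that
  proof (induction k rule: dec_induct)
    case (step k)
    then show ?case using assms(1)[of k] by auto
  qed auto
  have nth: "W k ! i = W n ! i" if "n \<le> k" "i < length (W n)" for n k i
    using mono[OF that(1)] that(2) by (auto simp: nth_append)
  show "stake (length (W n)) \<omega> = W n" for n
  proof (rule nth_equalityI)
    fix i assume "i < length (stake (length (W n)) \<omega>)"
    then have i: "i < length (W n)" by simp
    have "i < length (W (Suc i))" using len[of "Suc i"] by simp
    then have "W (Suc i) ! i = W n ! i"
      using nth[of n "Suc i" i] nth[of "Suc i" n i] i by (cases "n \<le> Suc i") auto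
    then show "stake (length (W n)) \<omega> ! i = W n ! i"
      using i by (simp add: \<omega>_def)
  qed simp
qed

text \<open>The combinatorial content of a Schreier graph with a geodesic spanning tree, whose arcs
  form \<open>E\<close>. The axiom \<open>geodesic\<close> supplies connectedness of the tree along
  with minimality of its paths from the root.\<close>

locale rooted_tree =
  fixes V :: "'v set" and st :: "'v \<Rightarrow> 'a letter \<Rightarrow> 'v" and rt :: 'v
    and E :: "('v \<times> 'a letter) set"
  assumes root [simp]: "rt \<in> V"
    and st_closed [simp]: "x \<in> V \<Longrightarrow> st x a \<in> V"
    and st_inv [simp]: "x \<in> V \<Longrightarrow> st (st x a) (inv_letter a) = x"
    and E_rev: "x \<in> V \<Longrightarrow> (x, a) \<in> E \<Longrightarrow> (st x a, inv_letter a) \<in> E"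
    and acyclic: "x \<in> V \<Longrightarrow> walk_in st E x w \<Longrightarrow> reduced w \<Longrightarrow> foldl st x w = x \<Longrightarrow> w = []"
    and geodesic: "x \<in> V \<Longrightarrow> \<exists>w. walk_in st E rt w \<and> foldl st rt w = x \<and>
      (\<forall>v. foldl st rt v = x \<longrightarrow> length w \<le> length v)"
begin

abbreviation mv :: "'v \<Rightarrow> 'a letter list \<Rightarrow> 'v" where "mv \<equiv> foldl st"

abbreviation tp :: "'v \<Rightarrow> 'a letter list \<Rightarrow> bool" where "tp \<equiv> walk_in st E"

lemma mv_closed [simp]: "x \<in> V \<Longrightarrow> mv x w \<in> V"
  by (induction w arbitrary: x) auto

lemma st_inv' [simp]: "x \<in> V \<Longrightarrow> st (st x (inv_letter a)) a = x"
  using st_inv[of x "inv_letter a"] by simp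

lemma mv_cons_red: "x \<in> V \<Longrightarrow> mv x (cons_red a w) = mv (st x a) w"
  by (cases w) (auto simp: cons_red_def)

lemma mv_reduce [simp]: "x \<in> V \<Longrightarrow> mv x (reduce w) = mv x w"
  by (induction w arbitrary: x) (auto simp: reduce_Cons mv_cons_red)

lemma mv_inv_word [simp]: "x \<in> V \<Longrightarrow> mv (mv x w) (inv_word w) = x"
  by (induction w arbitrary: x) auto

lemma tp_cons_red: "x \<in> V \<Longrightarrow> tp x (a # w) \<Longrightarrow> tp x (cons_red a w)"
  by (cases w) (auto simp: cons_red_def)

lemma tp_reduce: "x \<in> V \<Longrightarrow> tp x w \<Longrightarrow> tp x (reduce w)"
  by (induction w arbitrary: x) (auto simp: reduce_Cons intro!: tp_cons_red)

lemma tp_inv_word: "x \<in> V \<Longrightarrow> tp x w \<Longrightarrow> tp (mv x w) (inv_word w)"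
  by (induction w arbitrary: x) (auto simp: walk_in_append E_rev)

text \<open>Going back along \<open>u\<close> and out along \<open>v\<close> is a closed tree walk,
  so its reduction is trivial by \<open>acyclic\<close>.\<close>

lemma tp_unique:
  assumes "x \<in> V" "tp x u" "tp x v" "reduced u" "reduced v" "mv x u = mv x v"
  shows "u = v"
proof -
  have e: "mv (mv x u) (inv_word u) = x" "tp (mv x u) (inv_word u)"
    by (rule mv_inv_word[OF assms(1)], rule tp_inv_word[OF assms(1,2)])
  have "reduce (inv_word u @ v) = []"
  proof (rule acyclic[of "mv x u"])
    have "tp (mv x u) (inv_word u @ v)" by (simp only: walk_in_append e assms(3) simp_thms)
    then show "tp (mv x u) (reduce (inv_word u @ v))"
      using assms by (intro tp_reduce) auto
    show "mv (mv x u) (reduce (inv_word u @ v)) = mv x u"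
      unfolding mv_reduce[OF mv_closed[OF assms(1)]] foldl_append e(1) by (rule assms(6)[symmetric])
  qed (use assms in auto)
  then show ?thesis using assms by (simp add: reduce_eq_iff reduce_reduced)
qed

section \<open>Tree paths and Schreier generators\<close>

definition pth :: "'v \<Rightarrow> 'v \<Rightarrow> 'a letter list" where
  "pth x y = (THE w. reduced w \<and> tp x w \<and> mv x w = y)"

lemma pth_eqI:
  assumes "x \<in> V" "reduced w" "tp x w" "mv x w = y"
  shows "pth x y = w"
  unfolding pth_def using assms tp_unique[OF assms(1)] by (intro the_equality) auto

text \<open>For existence, walk in the tree from \<open>x\<close> to the root and on to
  \<open>y\<close>, then reduce.\<close>

lemma pth:
  assumes "x \<in> V" "y \<in> V"
  shows "reduced (pth x y)" "tp x (pth x y)" "mv x (pth x y) = y"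
proof -
  obtain u v where uv: "tp rt u" "mv rt u = x" "tp rt v" "mv rt v = y"
    using geodesic[OF assms(1)] geodesic[OF assms(2)] by blast
  let ?w = "reduce (inv_word u @ v)"
  have "tp (mv rt u) (inv_word u)" using uv by (intro tp_inv_word) auto
  then have "tp x (inv_word u @ v)" using mv_inv_word[of rt u] uv by (auto simp: walk_in_append)
  then have "tp x ?w" using assms by (intro tp_reduce) auto
  moreover have "mv x ?w = y" using assms mv_inv_word[of rt u] uv by simp
  ultimately have "pth x y = ?w" using assms by (intro pth_eqI) auto
  then show "reduced (pth x y)" "tp x (pth x y)" "mv x (pth x y) = y"
    using \<open>tp x ?w\<close> \<open>mv x ?w = y\<close> by auto
qed

lemma pth_self [simp]: "x \<in> V \<Longrightarrow> pth x x = []"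
  by (rule pth_eqI) auto

lemma pth_inv: "x \<in> V \<Longrightarrow> y \<in> V \<Longrightarrow> inv_word (pth x y) = pth y x"
  using mv_inv_word[of x "pth x y"] tp_inv_word[of x "pth x y"]
  by (intro pth_eqI[symmetric]) (auto simp: pth reduced_inv_word)

lemma reduce_pth_append:
  "x \<in> V \<Longrightarrow> y \<in> V \<Longrightarrow> z \<in> V \<Longrightarrow> reduce (pth x y @ pth y z) = pth x z"
  by (intro pth_eqI[symmetric] tp_reduce) (auto simp: walk_in_append pth)

text \<open>The minimal walk supplied by \<open>geodesic\<close> reduces to the tree path, and
  reduction never lengthens a word.\<close>

lemma length_pth_le:
  assumes "x \<in> V" "mv rt v = x"
  shows "length (pth rt x) \<le> length v"
proof -
  obtain w where w: "tp rt w" "mv rt w = x" "length w \<le> length v"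
    using geodesic[OF assms(1)] assms(2) by blast
  have "pth rt x = reduce w" using w by (intro pth_eqI tp_reduce) auto
  moreover have "length (reduce u) \<le> length u" for u :: "'a letter list"
    by (induction u) (auto simp: reduce_Cons cons_red_def)
  ultimately show ?thesis using w(3) le_trans by metis
qed

text \<open>The reverse of the last tree arc lies in \<open>E\<close>, so a letter that leaves the
  tree cannot cancel it.\<close>

lemma reduced_snoc_exit:
  assumes "x \<in> V" "tp x w" "reduced w" "(mv x w, a) \<notin> E"
  shows "reduced (w @ [a])"
proof (cases w rule: rev_cases)
  case (snoc w' b)
  then have "(st (mv x w') b, inv_letter b) \<in> E"
    using assms(1,2) by (intro E_rev) (auto simp: walk_in_append)
  then have "a \<noteq> inv_letter b" using assms snoc by auto
  then show ?thesis using assms snoc by (auto simp: reduced_append reduced_Cons)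
qed simp

lemma reduced_exit_Cons:
  assumes "x \<in> V" "(x, a) \<notin> E" "tp (st x a) w" "reduced w"
  shows "reduced (a # w)"
proof (cases w)
  case (Cons b w')
  have "b \<noteq> inv_letter a"
    using E_rev[of "st x a" "inv_letter a"] assms Cons by auto
  then show ?thesis using assms Cons by (auto simp: reduced_Cons)
qed simp

text \<open>The Schreier generator of an arc. No reduction is applied, because for arcs outside the
  tree the word is already reduced.\<close>

definition gen :: "'v \<times> 'a letter \<Rightarrow> 'a letter list" where
  "gen e = pth rt (fst e) @ [snd e] @ pth (st (fst e) (snd e)) rt"

definition ext :: "('v \<times> 'a letter) set" where
  "ext = V \<times> UNIV - E"

lemma reduced_gen: "e \<in> ext \<Longrightarrow> reduced (gen e)"
  using reduced_snoc_exit[of rt "pth rt (fst e)" "snd e"]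
    reduced_exit_Cons[of "fst e" "snd e" "pth (st (fst e) (snd e)) rt"]
  by (cases e) (auto simp: gen_def ext_def pth reduced_append)

text \<open>The arc \<open>e\<close> is the first one outside the tree on the closed path
  \<open>gen e\<close>, so it can be recovered from the word.\<close>

lemma gen_inj:
  assumes "e \<in> ext" "e' \<in> ext" "gen e = gen e'"
  shows "e = e'"
proof -
  have V: "fst e \<in> V" "fst e' \<in> V" "(fst e, snd e) \<notin> E" "(fst e', snd e') \<notin> E"
    using assms by (auto simp: ext_def)
  have "pth rt (fst e) = pth rt (fst e') \<and> snd e = snd e'"
    using first_exit_unique[of st E rt "pth rt (fst e)" "snd e" "pth rt (fst e')" "snd e'"] V assms(3)
    by (simp add: gen_def pth)
  moreover from this have "fst e = fst e'" by (metis pth(3)[OF root V(1)] pth(3)[OF root V(2)])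
  ultimately show ?thesis by (simp add: prod_eq_iff)
qed

lemma inv_word_gen: "e \<in> ext \<Longrightarrow> inv_word (gen e) = gen (st (fst e) (snd e), inv_letter (snd e))"
  by (cases e) (auto simp: gen_def ext_def pth_inv)

lemma rev_ext: "e \<in> ext \<Longrightarrow> (st (fst e) (snd e), inv_letter (snd e)) \<in> ext"
  using E_rev[of "st (fst e) (snd e)" "inv_letter (snd e)"] by (cases e) (auto simp: ext_def)

lemma gen_eq_inv_iff:
  "e \<in> ext \<Longrightarrow> e' \<in> ext \<Longrightarrow>
    gen e' = inv_word (gen e) \<longleftrightarrow> e' = (st (fst e) (snd e), inv_letter (snd e))"
  using gen_inj[of e' "(st (fst e) (snd e), inv_letter (snd e))"] rev_ext[of e] by (auto simp: inv_word_gen)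

section \<open>Exits of a ray from the tree\<close>

definition exits :: "'v \<Rightarrow> 'a letter stream \<Rightarrow> nat \<Rightarrow> bool" where
  "exits x \<omega> n \<longleftrightarrow> (mv x (stake n \<omega>), \<omega> !! n) \<notin> E"

text \<open>For the root this turns out to be the limit set. Other start vertices are allowed
  because a letter acting on a ray moves the start vertex.\<close>

definition inf_exits :: "'v \<Rightarrow> 'a letter stream set" where
  "inf_exits x = {\<omega> \<in> \<partial>\<F>. \<exists>\<^sub>F n in sequentially. exits x \<omega> n}"

definition tree_rays :: "'v \<Rightarrow> 'a letter stream set" where
  "tree_rays x = {\<omega> \<in> \<partial>\<F>. \<forall>n. \<not> exits x \<omega> n}"

lemma exits_sdrop: "exits (mv x (stake n \<omega>)) (sdrop n \<omega>) i \<longleftrightarrow> exits x \<omega> (n + i)"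
  by (simp add: exits_def sdrop_snth flip: foldl_append)

lemma walk_in_stake: "tp x (stake n \<omega>) \<longleftrightarrow> (\<forall>i<n. \<not> exits x \<omega> i)"
  by (induction n) (auto simp: stake_Suc walk_in_append exits_def less_Suc_eq simp del: stake.simps(2))

lemma inf_exits_SCons:
  assumes "a ## \<omega> \<in> \<partial>\<F>"
  shows "a ## \<omega> \<in> inf_exits x \<longleftrightarrow> \<omega> \<in> inf_exits (st x a)"
proof -
  have "exits x (a ## \<omega>) (Suc n) \<longleftrightarrow> exits (st x a) \<omega> n" for n
    by (simp add: exits_def)
  then have "(\<exists>\<^sub>F n in sequentially. exits x (a ## \<omega>) n) \<longleftrightarrow> (\<exists>\<^sub>F n in sequentially. exits (st x a) \<omega> n)"
    using eventually_sequentially_Suc[of "\<lambda>n. \<not> exits x (a ## \<omega>) n"] by (simp add: frequently_def)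
  then show ?thesis using assms by (auto simp: inf_exits_def boundary_SCons)
qed

lemma inf_exits_scons_red:
  assumes "\<omega> \<in> \<partial>\<F>" "x \<in> V"
  shows "scons_red a \<omega> \<in> inf_exits x \<longleftrightarrow> \<omega> \<in> inf_exits (st x a)"
proof (cases "shd \<omega> = inv_letter a")
  case True
  then have \<omega>: "\<omega> = inv_letter a ## stl \<omega>" by (metis stream.collapse)
  show ?thesis
    using inf_exits_SCons[of "inv_letter a" "stl \<omega>" "st x a"] assms \<omega>
    by (simp add: scons_red_def True)
next
  case False
  then show ?thesis using assms by (simp add: scons_red_def inf_exits_SCons boundary_SCons)
qed

text \<open>Prefixing or cancelling letters only shifts the times of the later exits. For
  \<open>g\<close> fixing the root this makes \<open>inf_exits rt\<close> invariant.\<close>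

lemma inf_exits_bdry_act:
  assumes "\<omega> \<in> \<partial>\<F>" "x \<in> V"
  shows "bdry_act g \<omega> \<in> inf_exits x \<longleftrightarrow> \<omega> \<in> inf_exits (mv x g)"
  using assms(2)
  by (induction g arbitrary: x) (auto simp: bdry_act_Cons inf_exits_scons_red bdry_act_boundary assms(1))

section \<open>Rays inside the tree as a fundamental domain\<close>

lemma tree_rays_SCons:
  assumes "a ## \<omega> \<in> \<partial>\<F>"
  shows "a ## \<omega> \<in> tree_rays x \<longleftrightarrow> (x, a) \<in> E \<and> \<omega> \<in> tree_rays (st x a)"
proof -
  have "(\<forall>n. P n) \<longleftrightarrow> P 0 \<and> (\<forall>n. P (Suc n))" for P :: "nat \<Rightarrow> bool"
    by (metis nat.exhaust)
  from this[of "\<lambda>n. \<not> exits x (a ## \<omega>) n"]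
  show ?thesis using assms by (auto simp: tree_rays_def exits_def boundary_SCons)
qed

lemma tree_rays_scons_red:
  assumes "\<omega> \<in> tree_rays (st x a)" "x \<in> V" "(x, a) \<in> E"
  shows "scons_red a \<omega> \<in> tree_rays x"
proof -
  have \<omega>: "\<omega> \<in> \<partial>\<F>" using assms by (simp add: tree_rays_def)
  show ?thesis
  proof (cases "shd \<omega> = inv_letter a")
    case True
    then have "\<omega> = inv_letter a ## stl \<omega>" by (metis stream.collapse)
    then have "stl \<omega> \<in> tree_rays (st (st x a) (inv_letter a))"
      using tree_rays_SCons[of "inv_letter a" "stl \<omega>" "st x a"] assms \<omega> by metis
    then show ?thesis using assms True by (simp add: scons_red_def)
  next
    case False
    then show ?thesis using assms \<omega> by (simp add: scons_red_def tree_rays_SCons boundary_SCons)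
  qed
qed

lemma tree_rays_bdry_act:
  "\<omega> \<in> tree_rays (mv x g) \<Longrightarrow> x \<in> V \<Longrightarrow> tp x g \<Longrightarrow> bdry_act g \<omega> \<in> tree_rays x"
  by (induction g arbitrary: x) (auto simp: bdry_act_Cons tree_rays_scons_red)

text \<open>For the Schreier graph this is the subgroup \<open>H\<close> itself, see
  \<open>stab_eq\<close>.\<close>

definition stab :: "'a letter list set" where
  "stab = {g. reduced g \<and> mv rt g = rt}"

text \<open>Cut the ray at a time \<open>n\<close> after all its exits, at the vertex
  \<open>x\<close>, and attach the remaining tail to the root by the tree path. The removed prefix
  \<open>u\<close>, closed up by the tree path from \<open>x\<close> to the root, is the required
  \<open>h\<close>.\<close>

lemma not_inf_exits_cover:
  assumes "\<omega> \<in> \<partial>\<F>" "\<omega> \<notin> inf_exits rt"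
  shows "\<exists>h\<in>stab. \<omega> \<in> bdry_act h ` tree_rays rt"
proof -
  obtain n where n: "\<And>i. i \<ge> n \<Longrightarrow> \<not> exits rt \<omega> i"
    using assms by (auto simp: inf_exits_def frequently_def eventually_sequentially)
  define u x where "u = stake n \<omega>" and "x = mv rt u"
  have x: "x \<in> V" by (simp add: x_def)
  have "sdrop n \<omega> \<in> tree_rays x"
    using n assms(1) by (auto simp: tree_rays_def exits_sdrop x_def u_def boundary_sdrop)
  then have \<delta>: "bdry_act (pth rt x) (sdrop n \<omega>) \<in> tree_rays rt"
    using x by (intro tree_rays_bdry_act) (auto simp: pth)
  define h where "h = reduce (u @ pth x rt)"
  have "h \<in> stab" using x by (simp add: h_def stab_def pth x_def[symmetric])
  have b: "sdrop n \<omega> \<in> \<partial>\<F>" "bdry_act (pth rt x) (sdrop n \<omega>) \<in> \<partial>\<F>"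
    using assms(1) by (auto intro: boundary_sdrop bdry_act_boundary)
  have "bdry_act h (bdry_act (pth rt x) (sdrop n \<omega>)) = bdry_act u (sdrop n \<omega>)"
    using b bdry_act_inv_word(1)[OF b(1), of "pth rt x"] x
    by (simp add: h_def bdry_act_reduce bdry_act_append pth_inv)
  also have "sdrop n \<omega> = bdry_act (inv_word u) \<omega>"
    by (simp add: u_def bdry_act_inv_stake)
  also have "bdry_act u (bdry_act (inv_word u) \<omega>) = \<omega>"
    using assms(1) by (rule bdry_act_inv_word)
  finally have "\<omega> = bdry_act h (bdry_act (pth rt x) (sdrop n \<omega>))"
    by (simp add: u_def bdry_act_inv_stake)
  then show ?thesis using \<delta> \<open>h \<in> stab\<close> by blast
qed

text \<open>The quotient \<open>g\<close> of \<open>h\<close> and \<open>h'\<close> maps a long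
  prefix \<open>u\<close> of one tree ray to a prefix \<open>v\<close> of the other. Both are
  reduced tree walks from the root to the same vertex, so they are equal and \<open>g\<close> is
  trivial.\<close>

lemma tree_rays_disjoint:
  assumes h: "h \<in> stab" "h' \<in> stab" and \<delta>: "\<delta> \<in> tree_rays rt" "\<delta>' \<in> tree_rays rt"
    and eq: "bdry_act h \<delta> = bdry_act h' \<delta>'"
  shows "h = h'"
proof -
  have b: "\<delta> \<in> \<partial>\<F>" "\<delta>' \<in> \<partial>\<F>" using \<delta> by (auto simp: tree_rays_def)
  \<comment> \<open>A prefix of length \<open>length g\<close> is long enough that \<open>g\<close>
    does not touch the rest of the ray.\<close>
  define g n where "g = reduce (inv_word h' @ h)" and "n = length g"
  define u v where "u = stake n \<delta>" and "v = reduce (g @ u)"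
  have "bdry_act g \<delta> = \<delta>'"
    using b bdry_act_inv_word(1)[OF b(2), of h'] by (simp add: g_def bdry_act_reduce bdry_act_append eq)
  then have \<delta>': "\<delta>' = v @- sdrop n \<delta>"
    using bdry_act_eventually[OF b(1), of g n] by (simp add: n_def u_def v_def)
  then have "v = stake (length v) \<delta>'" by (simp add: stake_shift)
  then have "tp rt v" using \<delta>(2) walk_in_stake[of rt "length v" \<delta>'] by (simp add: tree_rays_def)
  moreover have "tp rt u" using \<delta>(1) by (simp add: tree_rays_def u_def walk_in_stake)
  moreover have "mv rt v = mv rt u"
  proof -
    have "mv rt g = rt" using h mv_inv_word[of rt h'] by (simp add: g_def stab_def)
    then show ?thesis by (simp add: v_def)
  qed
  moreover have "reduced u" "reduced v" by (simp_all add: u_def v_def reduced_stake b)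
  ultimately have "v = u" by (intro tp_unique[of rt]) auto
  then have "reduce (g @ u) = reduce u" using \<open>reduced u\<close> by (simp add: v_def reduce_reduced)
  then have "reduce ((g @ u) @ inv_word u) = reduce (u @ inv_word u)"
    by (metis reduce_append_reduce(1))
  then have "reduce g = []" by (metis append.assoc append_Nil2 reduce_append_reduce(2) reduce_inv_word(2))
  then have "reduce h' = reduce h" by (simp add: g_def reduce_eq_iff[symmetric] reduce_reduced)
  then show ?thesis using h by (simp add: stab_def reduce_reduced)
qed

section \<open>The limit set\<close>

text \<open>A word in the Schreier generators is given by its sequence \<open>e\<close> of arcs
  outside the tree. The tree path leading to arc \<open>n\<close> starts at this vertex, the head of
  the previous arc or the root.\<close>

definition exit_vertex :: "(nat \<Rightarrow> 'v \<times> 'a letter) \<Rightarrow> nat \<Rightarrow> 'v" where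
  "exit_vertex e n = (case n of 0 \<Rightarrow> rt | Suc k \<Rightarrow> st (fst (e k)) (snd (e k)))"

primrec exit_word :: "(nat \<Rightarrow> 'v \<times> 'a letter) \<Rightarrow> nat \<Rightarrow> 'a letter list" where
  "exit_word e 0 = []"
| "exit_word e (Suc n) = exit_word e n @ pth (exit_vertex e n) (fst (e n)) @ [snd (e n)]"

lemma exit_vertex_simps [simp]:
  "exit_vertex e 0 = rt" "exit_vertex e (Suc n) = st (fst (e n)) (snd (e n))"
  by (simp_all add: exit_vertex_def)

context
  fixes e :: "nat \<Rightarrow> 'v \<times> 'a letter"
  assumes e: "\<And>n. e n \<in> ext"
begin

lemma exit_in: "fst (e n) \<in> V" "exit_vertex e n \<in> V"
  using e[of n] e[of "n - 1"] by (cases n; auto simp: ext_def)+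

lemma mv_exit_word: "mv rt (exit_word e n) = exit_vertex e n"
  by (induction n) (auto simp: pth exit_in)

text \<open>The product telescopes: the return to the root after one arc and the way out to the next
  arc reduce to the tree path between the two arcs.\<close>

lemma reduce_concat_gen:
  "reduce (concat (map (\<lambda>i. gen (e i)) [0..<n])) = reduce (exit_word e n @ pth (exit_vertex e n) rt)"
proof (induction n)
  case (Suc n)
  let ?y = "exit_vertex e n" and ?x = "fst (e n)" and ?y' = "exit_vertex e (Suc n)"
  let ?r = "snd (e n) # pth ?y' rt"
  have V: "?x \<in> V" "?y \<in> V" using exit_in[of n] by auto
  have "reduce (concat (map (\<lambda>i. gen (e i)) [0..<Suc n])) =
        reduce (exit_word e n @ pth ?y rt @ gen (e n))"
    using reduce_append_cong[OF Suc refl, of "gen (e n)"] by simp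
  also have "\<dots> = reduce (exit_word e n @ reduce (pth ?y rt @ pth rt ?x) @ ?r)"
    using reduce_append_cong[OF refl reduce_append_reduce(1)[of "pth ?y rt @ pth rt ?x" ?r],
        of "exit_word e n"]
    by (simp add: gen_def)
  also have "\<dots> = reduce (exit_word e n @ pth ?y ?x @ ?r)"
    using V by (simp add: reduce_pth_append)
  finally show ?case by simp
qed simp

lemma reduced_exit_word_pth:
  assumes "reduced (exit_word e n)"
  shows "reduced (exit_word e n @ pth (exit_vertex e n) rt)"
proof (cases n)
  case (Suc k)
  have "reduced (snd (e k) # pth (exit_vertex e n) rt)"
    using e[of k] exit_in[of n] Suc by (intro reduced_exit_Cons[of "fst (e k)"]) (auto simp: ext_def pth)
  then show ?thesis using assms Suc
      reduced_join[of "exit_word e k @ pth (exit_vertex e k) (fst (e k))" "snd (e k)"] by simp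
qed simp

lemma length_exit_word: "n \<le> length (exit_word e n)"
  by (induction n) auto

text \<open>The product of the first \<open>n\<close> generators is \<open>exit_word e n\<close>
  followed by the return path to the root, with no cancellation between them. It thus agrees with
  \<open>\<omega>\<close> on at least \<open>n\<close> letters.\<close>

lemma sigma_infty_exit_word:
  assumes "\<omega> \<in> \<partial>\<F>" "\<And>n. stake (length (exit_word e n)) \<omega> = exit_word e n"
    and \<xi>: "\<And>n. \<xi> !! n = gen (e n)"
  shows "sigma_infty \<xi> = \<omega>"
proof -
  have red: "reduced (exit_word e n)" for n using assms(2)[of n] reduced_stake[OF assms(1)] by metis
  have "stake n \<xi> = map (\<lambda>i. gen (e i)) [0..<n]" for n
    by (rule nth_equalityI) (auto simp: \<xi>)
  then have prod: "foldr (\<otimes>\<^bsub>\<F>\<^esub>) (stake n \<xi>) \<one>\<^bsub>\<F>\<^esub> =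
      exit_word e n @ pth (exit_vertex e n) rt" for n
    using reduced_exit_word_pth[OF red]
    by (simp add: foldr_mult_free_group reduce_concat_gen reduce_reduced)
  have "take k (exit_word e n @ pth (exit_vertex e n) rt) = stake k \<omega>" if "k \<le> n" for k n
  proof -
    have k: "k \<le> length (exit_word e n)" using that length_exit_word le_trans by blast
    then have "take k (exit_word e n) = take k (stake (length (exit_word e n)) \<omega>)"
      by (simp add: assms(2))
    then show ?thesis using k by (simp add: take_stake min_def)
  qed
  then have lim: "words_tendsto (\<lambda>n. foldr (\<otimes>\<^bsub>\<F>\<^esub>) (stake n \<xi>) \<one>\<^bsub>\<F>\<^esub>) \<omega>"
    unfolding words_tendsto_def prod eventually_sequentially by blast
  show ?thesis unfolding sigma_infty_def
    by (rule the_equality) (use lim assms(1) words_tendsto_unique in blast)+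
qed

text \<open>Arcs outside the tree never cancel against tree arcs. Cancellation can only occur when
  the tree path between two consecutive arcs is empty and the second arc is the reverse of the
  first.\<close>

lemma backtrack_free_iff:
  "(\<forall>n. reduced (exit_word e n)) \<longleftrightarrow> (\<forall>n. gen (e (Suc n)) \<noteq> inv_word (gen (e n)))"
proof
  assume red: "\<forall>n. reduced (exit_word e n)"
  show "\<forall>n. gen (e (Suc n)) \<noteq> inv_word (gen (e n))"
  proof safe
    fix n assume "gen (e (Suc n)) = inv_word (gen (e n))"
    then have "e (Suc n) = (st (fst (e n)) (snd (e n)), inv_letter (snd (e n)))"
      using gen_eq_inv_iff[OF e e] by blast
    then have "exit_word e (Suc (Suc n)) =
        exit_word e n @ pth (exit_vertex e n) (fst (e n)) @ [snd (e n), inv_letter (snd (e n))]"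
      using exit_in(2)[of "Suc n"] by simp
    then show False using red[rule_format, of "Suc (Suc n)"]
      by (simp add: reduced_append reduced_Cons del: exit_word.simps)
  qed
next
  assume nb: "\<forall>n. gen (e (Suc n)) \<noteq> inv_word (gen (e n))"
  show "\<forall>n. reduced (exit_word e n)"
  proof
    fix n show "reduced (exit_word e n)"
    proof (induction n)
      case (Suc n)
      let ?p = "pth (exit_vertex e n) (fst (e n))"
      have p: "reduced (?p @ [snd (e n)])"
        using e[of n] exit_in[of n]
        by (intro reduced_snoc_exit[of "exit_vertex e n"]) (auto simp: pth ext_def)
      show ?case
      proof (cases n)
        case 0
        then show ?thesis using p by simp
      next
        case n: (Suc k)
        have "hd (?p @ [snd (e n)]) \<noteq> inv_letter (snd (e k))"
        proof (cases "?p = []")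
          case True
          then have "exit_vertex e n = fst (e n)"
            using pth(3)[OF exit_in(2) exit_in(1), of n n] by simp
          moreover have "e n \<noteq> (st (fst (e k)) (snd (e k)), inv_letter (snd (e k)))"
            using nb[rule_format, of k] gen_eq_inv_iff[OF e e, of n k] n by simp
          ultimately show ?thesis using True n by (cases "e n") auto
        next
          case False
          have "reduced (snd (e k) # ?p)"
            using e[of k] exit_in[of n] n by (intro reduced_exit_Cons[of "fst (e k)"]) (auto simp: pth ext_def)
          then show ?thesis using False by (auto simp: reduced_Cons)
        qed
        moreover have "last (exit_word e n) = snd (e k)" using n by simp
        ultimately show ?thesis using p Suc reduced_append[of "exit_word e n" "?p @ [snd (e n)]"] by simp
      qed
    qed simp
  qed
qed

end

text \<open>A reduced sequence of generators yields a chain of reduced exit words, whose limit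
  crosses every arc of the sequence. Conversely, the successive exits of a ray give its
  generators.\<close>

lemma limit_set_eq:
  "sigma_infty ` reduced_streams (\<lambda>s. inv\<^bsub>\<F>\<^esub> s) (gen ` ext) = inf_exits rt"
proof (intro equalityI subsetI)
  fix \<omega> assume "\<omega> \<in> sigma_infty ` reduced_streams (\<lambda>s. inv\<^bsub>\<F>\<^esub> s) (gen ` ext)"
  then obtain \<xi> where \<xi>: "\<And>n. \<xi> !! n \<in> gen ` ext" "\<And>n. \<xi> !! Suc n \<noteq> inv\<^bsub>\<F>\<^esub> (\<xi> !! n)"
    and \<omega>: "\<omega> = sigma_infty \<xi>"
    by (auto simp: reduced_streams_def streams_iff_snth)
  from \<xi>(1) have "\<forall>n. \<exists>e. e \<in> ext \<and> \<xi> !! n = gen e" by blast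
  then obtain e where e: "\<And>n. e n \<in> ext" "\<And>n. \<xi> !! n = gen (e n)" by metis
  have "gen (e (Suc n)) \<noteq> inv_word (gen (e n))" for n
    using \<xi>(2)[of n] e reduced_gen by (simp add: inv_free_group del: snth.simps)
  then have red: "\<forall>n. reduced (exit_word e n)" using backtrack_free_iff[of e] e(1) by blast
  obtain \<eta> where \<eta>: "\<And>n. stake (length (exit_word e n)) \<eta> = exit_word e n"
    using prefix_chain_limit[of "exit_word e"] length_exit_word[of e] e(1) by auto
  have "reduced (stake n \<eta>)" for n
  proof -
    have "take n (exit_word e n) = stake n \<eta>"
      using \<eta>[of n] length_exit_word[of e n] e(1) by (metis min.absorb1 take_stake)
    moreover have "reduced (take n w)" if "reduced w" for w :: "'a letter list"
      using that by (metis append_take_drop_id reduced_append)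
    ultimately show ?thesis using red by metis
  qed
  then have b: "\<eta> \<in> \<partial>\<F>" using boundary_reduced_stake by blast
  \<comment> \<open>The arc \<open>e n\<close> is crossed by the last letter of
    \<open>exit_word e (Suc n)\<close>, hence the subtraction of one.\<close>
  have "exits rt \<eta> (length (exit_word e (Suc n)) - 1)" for n
  proof -
    let ?p = "exit_word e n @ pth (exit_vertex e n) (fst (e n))"
    have *: "stake (Suc (length ?p)) \<eta> = ?p @ [snd (e n)]" using \<eta>[of "Suc n"] by simp
    then have "stake (length ?p) \<eta> @ [\<eta> !! length ?p] = ?p @ [snd (e n)]"
      by (simp only: stake_Suc)
    then have "stake (length ?p) \<eta> = ?p" "\<eta> !! length ?p = snd (e n)" by auto
    moreover have "mv rt ?p = fst (e n)"
      using exit_in[of e n] e(1) mv_exit_word[of e n] by (simp add: pth)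
    ultimately have "exits rt \<eta> (length ?p)"
      using e(1)[of n] by (auto simp: exits_def ext_def simp del: foldl_append)
    then show ?thesis by simp
  qed
  moreover have "n \<le> length (exit_word e (Suc n)) - 1" for n
    using length_exit_word[of e "Suc n", OF e(1)] by linarith
  ultimately have "\<eta> \<in> inf_exits rt"
    using b by (auto simp: inf_exits_def frequently_def eventually_sequentially simp del: exit_word.simps)
  moreover have "\<omega> = \<eta>" using sigma_infty_exit_word[of e \<eta> \<xi>] e b \<eta> \<omega> by simp
  ultimately show "\<omega> \<in> inf_exits rt" by simp
next
  fix \<omega> assume "\<omega> \<in> inf_exits rt"
  then have b: "\<omega> \<in> \<partial>\<F>" and inf: "infinite {n. exits rt \<omega> n}" (is "infinite ?I")
    by (auto simp: inf_exits_def frequently_cofinite simp flip: cofinite_eq_sequentially)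
  \<comment> \<open>\<open>k n\<close> is the time of exit \<open>n\<close> and \<open>c n\<close>
    the time just after the previous exit (\<open>0\<close> at the start), so the segment between
    them is the tree path leading to exit \<open>n\<close>.\<close>
  define k where "k = enumerate ?I"
  define c where "c n = (case n of 0 \<Rightarrow> 0 | Suc i \<Rightarrow> Suc (k i))" for n
  define e where "e n = (mv rt (stake (k n) \<omega>), \<omega> !! k n)" for n
  have k: "exits rt \<omega> (k n)" for n using enumerate_in_set[OF inf, of n] by (simp add: k_def)
  then have e: "e n \<in> ext" for n by (simp add: e_def ext_def exits_def)
  have ck: "c n \<le> k n" for n
    using enumerate_mono[OF lessI inf] by (cases n) (auto simp: c_def k_def Suc_le_eq)
  \<comment> \<open>The enumeration \<open>k\<close> is increasing and meets all exits, so an exit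
    before \<open>k n\<close> also precedes \<open>c n\<close>.\<close>
  have gap: "\<not> exits rt \<omega> i" if "c n \<le> i" "i < k n" for i n
  proof
    assume "exits rt \<omega> i"
    then obtain j where j: "i = k j" using enumerate_Ex[OF, of ?I i] inf by (auto simp: k_def)
    then have "j < n" using that(2) inf by (simp add: k_def)
    then obtain l where l: "n = Suc l" "j \<le> l" by (cases n) auto
    then have "k j \<le> k l" using enumerate_mono_le_iff[OF inf] by (simp add: k_def)
    then show False using that(1) j l by (simp add: c_def)
  qed
  have y: "exit_vertex e n = mv rt (stake (c n) \<omega>)" for n
    by (cases n) (auto simp: c_def e_def stake_Suc simp del: stake.simps(2))
  have W: "exit_word e n = stake (c n) \<omega>" for n
  proof (induction n)
    case (Suc n)
    have "pth (exit_vertex e n) (fst (e n)) = stake (k n - c n) (sdrop (c n) \<omega>)"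
    proof (rule pth_eqI)
      show "reduced (stake (k n - c n) (sdrop (c n) \<omega>))"
        by (intro reduced_stake boundary_sdrop b)
      show "tp (exit_vertex e n) (stake (k n - c n) (sdrop (c n) \<omega>))"
        using gap[of n] by (auto simp: y walk_in_stake exits_sdrop)
      show "mv (exit_vertex e n) (stake (k n - c n) (sdrop (c n) \<omega>)) = fst (e n)"
        using ck[of n] by (simp add: y e_def flip: foldl_append)
    qed (simp add: y)
    then have "exit_word e (Suc n) =
        (stake (c n) \<omega> @ stake (k n - c n) (sdrop (c n) \<omega>)) @ [snd (e n)]"
      by (simp only: exit_word.simps Suc append_assoc)
    also have "\<dots> = stake (k n) \<omega> @ [\<omega> !! k n]"
      using ck[of n] unfolding stake_add by (simp add: e_def)
    finally show ?case by (simp add: c_def stake_Suc del: stake.simps(2))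
  qed (simp add: c_def)
  define \<xi> where "\<xi> = smap (\<lambda>n. gen (e n)) nats"
  have \<xi>: "\<xi> !! n = gen (e n)" for n by (simp add: \<xi>_def)
  have "\<forall>n. reduced (exit_word e n)" by (simp add: W reduced_stake b)
  then have "\<xi> \<in> reduced_streams (\<lambda>s. inv\<^bsub>\<F>\<^esub> s) (gen ` ext)"
    using backtrack_free_iff[of e] e reduced_gen
    by (auto simp: reduced_streams_def streams_iff_snth \<xi> inv_free_group simp del: snth.simps(2))
  moreover have "sigma_infty \<xi> = \<omega>"
    using e b \<xi> by (intro sigma_infty_exit_word[of e]) (auto simp: W)
  ultimately show "\<omega> \<in> sigma_infty ` reduced_streams (\<lambda>s. inv\<^bsub>\<F>\<^esub> s) (gen ` ext)" by blast
qed

section \<open>Geodesic rays\<close>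

definition geodesic_rays :: "'a letter stream set" where
  "geodesic_rays = {\<omega> \<in> \<partial>\<F>. \<forall>n v. mv rt v = mv rt (stake n \<omega>) \<longrightarrow> n \<le> length v}"

text \<open>A word \<open>v\<close> shorter than the prefix and ending at the same vertex would give
  the element \<open>v @ inv_word (stake n \<omega>)\<close> of the stabilizer, on which the cocycle
  is at most \<open>length v - n\<close>.\<close>

lemma nonneg_busemann_geodesic:
  assumes "\<omega> \<in> \<partial>\<F>" "\<And>h. h \<in> stab \<Longrightarrow> busemann h \<omega> \<ge> 0"
  shows "\<omega> \<in> geodesic_rays"
proof -
  have "n \<le> length v" if v: "mv rt v = mv rt (stake n \<omega>)" for n v
  proof -
    let ?u = "stake n \<omega>"
    have "mv (mv rt v) (inv_word ?u) = rt" using v mv_inv_word[of rt ?u] by simp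
    then have "reduce (v @ inv_word ?u) \<in> stab" by (simp add: stab_def)
    then have "0 \<le> busemann (v @ inv_word ?u) \<omega>"
      using assms busemann_reduce by metis
    also have "\<dots> \<le> int (length v) - int n"
      using busemann_le_length[of v] by (simp add: busemann_append busemann_inv_stake)
    finally show ?thesis by simp
  qed
  then show ?thesis using assms(1) by (simp add: geodesic_rays_def)
qed

text \<open>After leaving the tree along an edge to \<open>y\<close>, a geodesic ray can return towards the origin
  along the last edge of the tree path to \<open>y\<close>; this letter is thus forbidden.\<close>

lemma exit_forbids_letter:
  assumes \<omega>: "\<omega> \<in> geodesic_rays" and ex: "exits rt \<omega> n"
  defines "c \<equiv> inv_letter (last (pth rt (mv rt (stake (Suc n) \<omega>))))"
  shows "\<omega> !! Suc n \<noteq> c" "c \<noteq> inv_letter (\<omega> !! n)"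
proof -
  let ?x = "mv rt (stake n \<omega>)" and ?a = "\<omega> !! n"
  define y p where "y = mv rt (stake (Suc n) \<omega>)" and "p = pth rt y"
  have yx: "y = st ?x ?a" by (simp add: y_def stake_Suc del: stake.simps(2))
  have V: "?x \<in> V" "y \<in> V" by (simp_all add: y_def)
  have geo: "k \<le> length v" if "mv rt v = mv rt (stake k \<omega>)" for k v
    using \<omega> that by (auto simp: geodesic_rays_def)
  have p: "tp rt p" "mv rt p = y" using V by (simp_all add: p_def pth)
  \<comment> \<open>Otherwise the ray would be back at the root at time \<open>Suc n\<close>, which
    the empty word reaches faster.\<close>
  have "p \<noteq> []" using geo[of "[]" "Suc n"] p(2) by (auto simp: y_def simp del: stake.simps(2))
  then obtain p' b where pb: "p = p' @ [b]" by (metis rev_exhaust)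
  have z: "mv rt p' \<in> V" "st (mv rt p') b = y" "(mv rt p', b) \<in> E"
    using p by (simp_all add: pb walk_in_append)
  have c: "c = inv_letter b" unfolding c_def y_def[symmetric] p_def[symmetric] by (simp add: pb)
  \<comment> \<open>Otherwise the last arc of the tree path would be the exit arc. The forbidden
    letter thus differs from the one that reducedness excludes anyway.\<close>
  have "b \<noteq> ?a"
  proof
    assume "b = ?a"
    then have "mv rt p' = ?x" using z(1,2) V(1) yx by (metis st_inv)
    then show False using z(3) ex \<open>b = ?a\<close> by (simp add: exits_def)
  qed
  then show "c \<noteq> inv_letter ?a" by (simp add: c)
  have "length p \<le> Suc n" using length_pth_le[of y "stake (Suc n) \<omega>"] V by (simp add: p_def y_def)
  \<comment> \<open>The letter \<open>c\<close> would lead to the end of \<open>p'\<close> at time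
    \<open>n + 2\<close>, although \<open>p'\<close> has length at most \<open>n\<close>.\<close>
  show "\<omega> !! Suc n \<noteq> c"
  proof
    assume "\<omega> !! Suc n = c"
    then have "mv rt (stake (Suc (Suc n)) \<omega>) = st y (inv_letter b)"
      by (subst stake_Suc) (simp add: y_def c del: stake.simps(2))
    also have "\<dots> = mv rt p'" using z st_inv by metis
    finally have "Suc (Suc n) \<le> length p'" using geo by metis
    then show False using \<open>length p \<le> Suc n\<close> pb by simp
  qed
qed

end

section \<open>Geodesic rays rarely leave the tree\<close>

text \<open>Summation of a bound on relative measure over disjoint pieces; it is used for the
  cylinders of first exits.\<close>

lemma (in finite_measure) measure_Int_le_countable:
  assumes "countable I" "disjoint_family_on C I" "\<And>i. i \<in> I \<Longrightarrow> C i \<in> sets M"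
    and "Z \<in> sets M" "U \<in> sets M" "0 \<le> c"
    and le: "\<And>i. i \<in> I \<Longrightarrow> measure M (Z \<inter> C i) \<le> c * measure M (C i)"
    and "Z \<inter> U \<subseteq> (\<Union>i\<in>I. C i)" "(\<Union>i\<in>I. C i) \<subseteq> U"
  shows "measure M (Z \<inter> U) \<le> c * measure M U"
proof -
  have UN: "(\<Union>i\<in>I. C i) \<in> sets M" using assms by (intro sets.countable_UN') auto
  have "emeasure M (Z \<inter> U) = emeasure M (\<Union>i\<in>I. Z \<inter> C i)"
    using assms by (intro arg_cong[where f = "emeasure M"]) blast
  also have "\<dots> = (\<integral>\<^sup>+i. emeasure M (Z \<inter> C i) \<partial>count_space I)"
    using assms by (intro emeasure_UN_countable) (auto simp: disjoint_family_on_def)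
  also have "\<dots> \<le> (\<integral>\<^sup>+i. ennreal c * emeasure M (C i) \<partial>count_space I)"
    using le \<open>0 \<le> c\<close>
    by (intro nn_integral_mono) (auto simp: emeasure_eq_measure ennreal_mult[symmetric] intro: ennreal_leI)
  also have "\<dots> = ennreal c * (\<integral>\<^sup>+i. emeasure M (C i) \<partial>count_space I)"
    by (rule nn_integral_cmult) auto
  also have "(\<integral>\<^sup>+i. emeasure M (C i) \<partial>count_space I) = emeasure M (\<Union>i\<in>I. C i)"
    using assms by (intro emeasure_UN_countable[symmetric]) auto
  also have "\<dots> \<le> emeasure M U" using assms by (intro emeasure_mono) auto
  finally show ?thesis using \<open>0 \<le> c\<close>
    by (simp add: emeasure_eq_measure mult_left_mono flip: ennreal_mult)
qed

locale boundary_tree = uniform_boundary m + rooted_tree V st rt E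
  for m :: "'a::finite letter stream measure" and V :: "'v set"
    and st :: "'v \<Rightarrow> 'a letter \<Rightarrow> 'v" and rt :: 'v and E :: "('v \<times> 'a letter) set"
begin

section \<open>Measurability of the exit conditions\<close>

lemma exits_sets: "{\<omega> \<in> \<partial>\<F>. exits x \<omega> n} \<in> sets m"
proof -
  have "exits x \<omega> n \<longleftrightarrow> (mv x (butlast (stake (Suc n) \<omega>)), last (stake (Suc n) \<omega>)) \<notin> E" for \<omega>
    by (simp add: exits_def stake_Suc del: stake.simps)
  then show ?thesis
    using stake_sets[of "\<lambda>u. (mv x (butlast u), last u) \<notin> E" "Suc n"] by (simp del: stake.simps)
qed

lemma inf_exits_sets [measurable]: "inf_exits x \<in> sets m"
proof -
  have "inf_exits x = (\<Inter>N. \<Union>n\<in>{N..}. {\<omega> \<in> \<partial>\<F>. exits x \<omega> n})"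
    by (fastforce simp: inf_exits_def frequently_def eventually_sequentially)
  also have "\<dots> \<in> sets m"
    using exits_sets by (intro sets.countable_INT sets.countable_UN') auto
  finally show ?thesis .
qed

lemma tree_rays_sets [measurable]: "tree_rays x \<in> sets m"
proof -
  have "tree_rays x = (\<Inter>n. \<partial>\<F> - {\<omega> \<in> \<partial>\<F>. exits x \<omega> n})"
    by (auto simp: tree_rays_def)
  also have "\<dots> \<in> sets m"
    using exits_sets by (intro sets.countable_INT) auto
  finally show ?thesis .
qed

lemma geodesic_rays_sets [measurable]: "geodesic_rays \<in> sets m"
proof -
  have "geodesic_rays = (\<Inter>n. {\<omega> \<in> \<partial>\<F>. \<forall>v. mv rt v = mv rt (stake n \<omega>) \<longrightarrow> n \<le> length v})"
    by (auto simp: geodesic_rays_def)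
  also have "\<dots> \<in> sets m"
    by (intro sets.countable_INT image_subsetI stake_sets) simp
  finally show ?thesis .
qed

text \<open>Each exit leaves only \<open>q - 1\<close> of the \<open>q\<close> admissible next
  letters and so costs a factor \<open>1 - 1 / q\<close>; the induction counts \<open>k\<close>
  exits. As \<open>u\<close> is nonempty, each further admissible letter divides the measure by
  exactly \<open>q\<close>.\<close>

lemma measure_geodesic_exits_decay:
  assumes "u \<noteq> []"
  shows "measure m (geodesic_rays \<inter> inf_exits rt \<inter> cylinder u) \<le> (1 - 1 / q) ^ k * measure m (cylinder u)"
  using assms
proof (induction k arbitrary: u)
  case 0
  show ?case by (auto intro: finite_measure_mono)
next
  case (Suc k)
  let ?Z = "geodesic_rays \<inter> inf_exits rt" and ?c = "1 - 1 / q"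
  \<comment> \<open>The prefixes of rays up to and including their first exit at or after time
    \<open>length u\<close>.\<close>
  define I where "I = {u @ t @ [a] | t a. tp (mv rt u) t \<and> (mv rt (u @ t), a) \<notin> E}"
  have c: "0 \<le> ?c" using q_ge_1 by simp
  have bound: "measure m (?Z \<inter> cylinder v) \<le> ?c ^ Suc k * measure m (cylinder v)" if "v \<in> I" for v
  proof (cases "?Z \<inter> cylinder v = {}")
    case True
    have "0 \<le> ?c ^ Suc k * measure m (cylinder v)"
      using c by (intro mult_nonneg_nonneg zero_le_power) auto
    then show ?thesis using True by simp
  next
    case False
    obtain t a where v: "v = u @ t @ [a]" and a: "(mv rt (u @ t), a) \<notin> E"
      using \<open>v \<in> I\<close> unfolding I_def by blast
    define n where "n = length (u @ t)"
    have *: "stake (Suc n) \<omega> = v" "exits rt \<omega> n" "\<omega> !! n = a" if "\<omega> \<in> cylinder v" for \<omega>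
    proof -
      show st: "stake (Suc n) \<omega> = v" using that by (simp add: cylinder_def v n_def)
      then have "stake n \<omega> @ [\<omega> !! n] = (u @ t) @ [a]" by (simp add: stake_Suc v del: stake.simps)
      then have "stake n \<omega> = u @ t" "\<omega> !! n = a" by blast+
      then show "exits rt \<omega> n" "\<omega> !! n = a" using a by (simp_all add: exits_def)
    qed
    define f where "f = inv_letter (last (pth rt (mv rt v)))"
    define L where "L = UNIV - {inv_letter a, f}"
    \<comment> \<open>This needs an actual geodesic ray through \<open>v\<close>, hence the case
      distinction. The two letters missing from \<open>L\<close> are then distinct, which leaves
      \<open>q - 1\<close> of the \<open>q + 1\<close> letters.\<close>
    have f: "f \<noteq> inv_letter a"
    proof -
      obtain \<omega> where "\<omega> \<in> geodesic_rays" "\<omega> \<in> cylinder v" using False by blast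
      then show ?thesis using exit_forbids_letter(2)[of \<omega> n] * by (simp add: f_def del: stake.simps)
    qed
    have "reduced v" using False cylinder_not_reduced[of v] by auto
    have cover: "?Z \<inter> cylinder v \<subseteq> (\<Union>b\<in>L. ?Z \<inter> cylinder (v @ [b]))"
    proof
      fix \<omega> assume \<omega>: "\<omega> \<in> ?Z \<inter> cylinder v"
      then have "\<omega> !! Suc n \<noteq> f"
        using exit_forbids_letter(1)[of \<omega> n] * by (simp add: f_def del: stake.simps snth.simps)
      moreover have "\<omega> !! Suc n \<noteq> inv_letter a"
        using \<omega> *(3)[of \<omega>] by (auto simp: cylinder_def boundary_iff simp del: snth.simps)
      moreover have "stake (Suc (Suc n)) \<omega> = v @ [\<omega> !! Suc n]"
        using \<omega> *(1)[of \<omega>] by (subst stake_Suc) (simp del: stake.simps snth.simps)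
      then have "\<omega> \<in> cylinder (v @ [\<omega> !! Suc n])"
        using \<omega> by (simp add: cylinder_def v n_def del: stake.simps snth.simps)
      ultimately show "\<omega> \<in> (\<Union>b\<in>L. ?Z \<inter> cylinder (v @ [b]))" using \<omega> by (auto simp: L_def)
    qed
    have cardL: "real (card L) = q - 1"
    proof -
      have "card L = 2 * CARD('a) - 2"
        using f by (simp add: L_def card_Diff_subset card_prod card_UNIV_bool)
      moreover have "CARD('a) \<ge> 1" by (simp add: Suc_le_eq)
      ultimately show ?thesis by (simp add: q_def)
    qed
    have "measure m (?Z \<inter> cylinder v) \<le> measure m (\<Union>b\<in>L. ?Z \<inter> cylinder (v @ [b]))"
      using cover by (intro finite_measure_mono) auto
    also have "\<dots> \<le> (\<Sum>b\<in>L. measure m (?Z \<inter> cylinder (v @ [b])))"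
      by (intro measure_UNION_le) auto
    also have "\<dots> \<le> (\<Sum>b\<in>L. ?c ^ k * (measure m (cylinder v) / q))"
    proof (rule sum_mono)
      fix b assume "b \<in> L"
      then have "reduced (v @ [b])"
        using \<open>reduced v\<close> reduced_join[of "u @ t" a "[b]"] by (simp add: L_def v reduced_Cons)
      then have "measure m (cylinder (v @ [b])) = measure m (cylinder v) / q"
        by (intro measure_cylinder_snoc) (auto simp: v)
      then show "measure m (?Z \<inter> cylinder (v @ [b])) \<le> ?c ^ k * (measure m (cylinder v) / q)"
        using Suc.IH[of "v @ [b]"] by simp
    qed
    also have "\<dots> = ?c ^ Suc k * measure m (cylinder v)"
      using q_ge_1 by (simp add: cardL field_simps)
    finally show ?thesis .
  qed
  \<comment> \<open>Cylinders that meet come from words of which one is a prefix of the other, and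
    uniqueness of the first exit makes such words in \<open>I\<close> equal.\<close>
  have disj: "disjoint_family_on cylinder I"
  proof -
    have eq: "v = v'" if I: "v \<in> I" "v' \<in> I" and w: "v' = v @ w" for v v' w
    proof -
      obtain t a t' a' where v: "v = u @ t @ [a]" "tp (mv rt u) t" "(mv rt (u @ t), a) \<notin> E"
        "v' = u @ t' @ [a']" "tp (mv rt u) t'" "(mv rt (u @ t'), a') \<notin> E"
        using I by (auto simp: I_def)
      then have "t @ a # w = t' @ a' # []" using w by simp
      then show ?thesis using first_exit_unique[of st E "mv rt u" t a t' a' w "[]"] v by simp
    qed
    have "v = v'" if "v \<in> I" "v' \<in> I" "\<omega> \<in> cylinder v" "\<omega> \<in> cylinder v'" for v v' \<omega>
      using cylinder_nested(2)[of \<omega> v v'] cylinder_nested(2)[of \<omega> v' v] eq that nat_le_linear by metis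
    then show ?thesis by (auto simp: disjoint_family_on_def)
  qed
  show ?case
  proof (rule measure_Int_le_countable[OF _ disj _ _ _ _ bound])
    show "?Z \<inter> cylinder u \<subseteq> (\<Union>v\<in>I. cylinder v)"
    proof
      fix \<omega> assume \<omega>: "\<omega> \<in> ?Z \<inter> cylinder u"
      let ?l = "length u"
      have "\<exists>n\<ge>?l. exits rt \<omega> n"
        using \<omega> by (auto simp: inf_exits_def frequently_def eventually_sequentially)
      then obtain n where n: "n \<ge> ?l" "exits rt \<omega> n" "\<And>i. ?l \<le> i \<Longrightarrow> i < n \<Longrightarrow> \<not> exits rt \<omega> i"
        using exists_least_iff[of "\<lambda>n. n \<ge> ?l \<and> exits rt \<omega> n"] by blast
      define t where "t = stake (n - ?l) (sdrop ?l \<omega>)"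
      have u: "stake ?l \<omega> = u" using \<omega> by (simp add: cylinder_def)
      have ut: "u @ t = stake n \<omega>" using n(1) stake_add[of ?l \<omega> "n - ?l"] by (simp add: t_def u)
      have "tp (mv rt u) t"
        using n(3) exits_sdrop[of rt ?l \<omega>] by (auto simp: t_def walk_in_stake u)
      moreover have "(mv rt (u @ t), \<omega> !! n) \<notin> E"
        using n(2) by (simp add: ut exits_def del: foldl_append)
      ultimately have "u @ t @ [\<omega> !! n] \<in> I" unfolding I_def by blast
      moreover have "stake (Suc n) \<omega> = u @ t @ [\<omega> !! n]"
        using ut by (simp add: stake_Suc del: stake.simps)
      then have "\<omega> \<in> cylinder (u @ t @ [\<omega> !! n])"
        using \<omega> arg_cong[OF ut, of length] by (simp add: cylinder_def del: stake.simps)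
      ultimately show "\<omega> \<in> (\<Union>v\<in>I. cylinder v)" by blast
    qed
    show "(\<Union>v\<in>I. cylinder v) \<subseteq> cylinder u"
      using cylinder_append_subset[of u] by (fastforce simp: I_def)
  qed (use c in auto)
qed

text \<open>Let the number of exits tend to infinity in the decay estimate, on each of the finitely
  many one-letter cylinders.\<close>

lemma geodesic_exits_null: "geodesic_rays \<inter> inf_exits rt \<in> null_sets m"
proof -
  let ?Z = "geodesic_rays \<inter> inf_exits rt"
  have "?Z \<inter> cylinder [a] \<in> null_sets m" for a
  proof -
    have "(\<lambda>k. (1 - 1 / q) ^ k * measure m (cylinder [a])) \<longlonglongrightarrow> 0 * measure m (cylinder [a])"
      using q_ge_1 by (intro tendsto_intros LIMSEQ_power_zero) auto
    then have "measure m (?Z \<inter> cylinder [a]) \<le> 0"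
      using measure_geodesic_exits_decay[of "[a]"] by (intro LIMSEQ_le_const) auto
    then have "measure m (?Z \<inter> cylinder [a]) = 0" by (simp add: order_antisym)
    then show ?thesis by (auto simp: null_sets_def emeasure_eq_measure)
  qed
  then have "(\<Union>a. ?Z \<inter> cylinder [a]) \<in> null_sets m" by (rule null_sets_UN)
  also have "(\<Union>a. ?Z \<inter> cylinder [a]) = ?Z"
    by (auto simp: cylinder_def geodesic_rays_def)
  finally show ?thesis .
qed

section \<open>The Hopf decomposition\<close>

lemma stab_Nil: "[] \<in> stab"
  and stab_inv: "h \<in> stab \<Longrightarrow> inv_word h \<in> stab"
  and stab_mult: "g \<in> stab \<Longrightarrow> h \<in> stab \<Longrightarrow> reduce (g @ h) \<in> stab"
  using mv_inv_word[of rt h] by (auto simp: stab_def reduced_inv_word)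

lemma stab_image_image:
  assumes "B \<subseteq> \<partial>\<F>"
  shows "bdry_act g ` bdry_act h ` B = bdry_act (reduce (g @ h)) ` B"
  using assms by (force simp: bdry_act_reduce bdry_act_append)

lemma bdry_act_inf_exits: "h \<in> stab \<Longrightarrow> bdry_act h ` inf_exits rt = inf_exits rt"
proof -
  assume h: "h \<in> stab"
  have sub: "inf_exits rt \<subseteq> \<partial>\<F>" by (auto simp: inf_exits_def)
  show ?thesis
    using stab_inv[OF h] sub
    by (auto simp: bdry_act_image[OF sub] inf_exits_bdry_act stab_def)
qed

abbreviation disjoint_translates :: "'a letter stream set \<Rightarrow> bool" where
  "disjoint_translates W \<equiv> disjoint_family_on (\<lambda>g. bdry_act g ` W) stab"

lemma disjoint_translates_subset: "disjoint_translates W \<Longrightarrow> W' \<subseteq> W \<Longrightarrow> disjoint_translates W'"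
  unfolding disjoint_family_on_def by blast

text \<open>Right multiplication by \<open>h\<close> is injective, so distinct translates of the
  image are distinct translates of \<open>W\<close>.\<close>

lemma disjoint_translates_image:
  assumes "disjoint_translates W" "W \<subseteq> \<partial>\<F>" "h \<in> stab"
  shows "disjoint_translates (bdry_act h ` W)"
  unfolding disjoint_family_on_def
proof (intro ballI impI)
  fix g g' assume g: "g \<in> stab" "g' \<in> stab" "g \<noteq> g'"
  have "reduce (g @ h) \<noteq> reduce (g' @ h)"
  proof
    assume "reduce (g @ h) = reduce (g' @ h)"
    then have "reduce ((g @ h) @ inv_word h) = reduce ((g' @ h) @ inv_word h)"
      by (metis reduce_append_reduce(1))
    then have "reduce g = reduce g'"
      by (metis append.assoc append_Nil2 reduce_append_reduce(2) reduce_inv_word(2))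
    then show False using g by (simp add: stab_def reduce_reduced)
  qed
  then show "bdry_act g ` bdry_act h ` W \<inter> bdry_act g' ` bdry_act h ` W = {}"
    using assms g stab_mult by (simp add: stab_image_image disjoint_family_on_def)
qed

text \<open>Almost every point of \<open>W\<close> is expanded by at least \<open>q ^ k\<close>
  under some element of the stabilizer, for every \<open>k\<close>, while the disjoint images have
  total mass at most \<open>1\<close>. Hence \<open>W\<close> has measure at most
  \<open>(1 / q) ^ k\<close>.\<close>

lemma wandering_null:
  assumes q: "q > 1" and W: "W \<in> sets m" "W \<subseteq> inf_exits rt" "disjoint_translates W"
  shows "emeasure m W = 0"
proof -
  define Z where "Z = geodesic_rays \<inter> inf_exits rt"
  have Z: "Z \<in> null_sets m" "Z \<subseteq> \<partial>\<F>" using geodesic_exits_null by (auto simp: Z_def geodesic_rays_def)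
  \<comment> \<open>The union runs over all words, of which there are countably many; a point of the
    boundary outside \<open>N\<close> has no translate in \<open>Z\<close>.\<close>
  define N where "N = (\<Union>h. bdry_act h ` Z)"
  have N: "N \<in> null_sets m" unfolding N_def by (intro null_sets_UN bdry_act_null_sets Z)
  have b: "\<omega> \<in> \<partial>\<F>" if "\<omega> \<in> W" for \<omega> using that W by (auto simp: inf_exits_def)
  \<comment> \<open>The translate by \<open>h\<close> remains in the limit set and avoids
    \<open>Z\<close>, so it is not geodesic. By \<open>nonneg_busemann_geodesic\<close> some
    \<open>g\<close> then lowers the integer-valued cocycle by at least one more.\<close>
  have unbounded: "\<exists>h\<in>stab. busemann h \<omega> \<le> - int k" if \<omega>: "\<omega> \<in> W - N" for \<omega> k
  proof (induction k)
    case 0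
    then show ?case using stab_Nil by force
  next
    case (Suc k)
    then obtain h where h: "h \<in> stab" "busemann h \<omega> \<le> - int k" by blast
    have bh: "bdry_act h \<omega> \<in> \<partial>\<F>" using \<omega> b by (auto intro: bdry_act_boundary)
    have "bdry_act h \<omega> \<in> inf_exits rt" using \<omega> W(2) h(1) bdry_act_inf_exits by blast
    moreover have "bdry_act h \<omega> \<notin> Z"
    proof
      assume "bdry_act h \<omega> \<in> Z"
      then have "bdry_act (inv_word h) (bdry_act h \<omega>) \<in> N" by (auto simp: N_def)
      then show False using \<omega> b by (auto simp: bdry_act_inv_word)
    qed
    ultimately have "bdry_act h \<omega> \<notin> geodesic_rays" by (simp add: Z_def)
    then obtain g where g: "g \<in> stab" "busemann g (bdry_act h \<omega>) < 0"
      using nonneg_busemann_geodesic[OF bh] by (meson not_le)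
    have "busemann (reduce (g @ h)) \<omega> \<le> - int (Suc k)"
      using \<omega> b g h by (simp add: busemann_reduce busemann_append)
    then show ?case using stab_mult[OF g(1) h(1)] by blast
  qed
  have bound: "ennreal (q ^ k) * emeasure m W \<le> 1" for k
  proof -
    define S where "S h = (W - N) \<inter> {\<omega> \<in> \<partial>\<F>. busemann h \<omega> \<le> - int k}" for h
    have S: "S h \<in> sets m" for h
      using N W busemann_sets[of "\<lambda>i. i \<le> - int k" h] by (auto simp: S_def)
    have "W - N \<subseteq> (\<Union>h\<in>stab. S h)" using unbounded b by (force simp: S_def)
    define F where "F h = bdry_act h ` S h" for h
    have F: "F h \<in> sets m" for h using S by (simp add: F_def)
    have disj: "disjoint_family_on F stab"
      using W(3) unfolding disjoint_family_on_def F_def S_def by blast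
    \<comment> \<open>The series below run over the naturals, so \<open>stab\<close> is encoded by
      \<open>to_nat\<close>; indices outside \<open>J\<close> receive the empty set.\<close>
    define e where "e i = (from_nat i :: 'a letter list)" for i
    define J where "J = to_nat ` stab"
    have eJ: "e i \<in> stab" "to_nat (e i) = i" if "i \<in> J" for i using that by (auto simp: J_def e_def)
    define S' where "S' i = (if i \<in> J then S (e i) else {})" for i
    define F' where "F' i = (if i \<in> J then F (e i) else {})" for i
    have S': "range S' \<subseteq> sets m" and F': "range F' \<subseteq> sets m" using S F by (auto simp: S'_def F'_def)
    have disj': "disjoint_family F'"
      unfolding disjoint_family_on_def
    proof (intro ballI impI)
      fix i j :: nat assume ij: "i \<noteq> j"
      show "F' i \<inter> F' j = {}"
      proof (cases "i \<in> J \<and> j \<in> J")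
        case True
        then have "e i \<noteq> e j" using eJ(2) ij by metis
        then show ?thesis using True disj eJ(1) by (auto simp: F'_def disjoint_family_on_def)
      qed (auto simp: F'_def)
    qed
    have "W - N \<subseteq> (\<Union>i. S' i)"
    proof
      fix \<omega> assume "\<omega> \<in> W - N"
      then obtain h where "h \<in> stab" "\<omega> \<in> S h" using \<open>W - N \<subseteq> (\<Union>h\<in>stab. S h)\<close> by blast
      then have "\<omega> \<in> S' (to_nat h)" by (auto simp: S'_def J_def e_def)
      then show "\<omega> \<in> (\<Union>i. S' i)" by blast
    qed
    then have "emeasure m (W - N) \<le> emeasure m (\<Union>i. S' i)" using S' by (intro emeasure_mono) auto
    also have "\<dots> \<le> (\<Sum>i. emeasure m (S' i))" using S' by (rule emeasure_subadditive_countably)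
    finally have "ennreal (q ^ k) * emeasure m (W - N) \<le> ennreal (q ^ k) * (\<Sum>i. emeasure m (S' i))"
      by (rule mult_left_mono) simp
    also have "\<dots> = (\<Sum>i. ennreal (q ^ k) * emeasure m (S' i))" by simp
    also have "\<dots> \<le> (\<Sum>i. emeasure m (F' i))"
    proof (rule suminf_le)
      fix i
      have "ennreal (q ^ k) * emeasure m (S h) \<le> emeasure m (F h)" for h
        unfolding F_def using S by (intro emeasure_bdry_act_expand) (auto simp: S_def)
      then show "ennreal (q ^ k) * emeasure m (S' i) \<le> emeasure m (F' i)"
        by (simp add: S'_def F'_def)
    qed auto
    also have "\<dots> = emeasure m (\<Union>i. F' i)" by (rule suminf_emeasure[OF F' disj'])
    also have "\<dots> \<le> 1" by (simp add: emeasure_eq_measure)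
    also have "emeasure m (W - N) = emeasure m W" using N W(1) by (rule emeasure_Diff_null_set)
    finally show ?thesis .
  qed
  have "measure m W \<le> (1 / q) ^ k" for k
  proof -
    have "q ^ k * measure m W \<le> 1"
      using bound[of k] q by (simp add: emeasure_eq_measure flip: ennreal_mult)
    then show ?thesis using q by (simp add: field_simps)
  qed
  moreover have "(\<lambda>k. (1 / q) ^ k) \<longlonglongrightarrow> 0" using q by (intro LIMSEQ_power_zero) auto
  ultimately have "measure m W \<le> 0" by (intro LIMSEQ_le_const) auto
  then show ?thesis by (simp add: emeasure_eq_measure measure_le_0_iff)
qed

abbreviation stab_group :: "'a letter list monoid" where
  "stab_group \<equiv> \<F>\<lparr>carrier := stab\<rparr>"

lemma stab_group_simps: "carrier stab_group = stab" "\<one>\<^bsub>stab_group\<^esub> = []"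
  by (simp_all add: free_group_def)

text \<open>Recurrence places almost every point of \<open>W\<close> in a nontrivial translate of
  \<open>W\<close>, whereas disjointness of the translates places none there.\<close>

lemma wandering_null_conservative:
  assumes C: "C \<in> sets m" "conservative_action stab_group bdry_act (restrict_space m C)"
    and W: "W \<in> sets m" "W \<subseteq> C" "disjoint_translates W"
  shows "W \<in> null_sets m"
proof (rule ccontr)
  assume "W \<notin> null_sets m"
  then have "emeasure m W > 0" using W by (auto simp: null_sets_def zero_less_iff_neq_zero)
  moreover have R: "emeasure (restrict_space m C) W = emeasure m W" "W \<in> sets (restrict_space m C)"
    using C W by (auto simp: emeasure_restrict_space sets_restrict_space_iff)
  ultimately have "recurrent_set stab_group bdry_act (restrict_space m C) W"
    using C by (auto simp: conservative_action_def)
  then have "AE \<omega> in m. \<omega> \<in> C \<longrightarrow> \<omega> \<in> W \<longrightarrow> \<omega> \<in> (\<Union>g\<in>stab - {[]}. bdry_act g ` W)"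
    using C by (simp add: recurrent_set_def stab_group_simps AE_restrict_space_iff free_group_def)
  moreover have "\<omega> \<notin> (\<Union>g\<in>stab - {[]}. bdry_act g ` W)" if "\<omega> \<in> W" for \<omega>
    using W(3) stab_Nil that unfolding disjoint_family_on_def by fastforce
  ultimately have "AE \<omega> in m. \<omega> \<notin> W" using W(2) by (auto elim: eventually_mono)
  then show False using \<open>W \<notin> null_sets m\<close> W(1) by (simp add: AE_iff_null_sets)
qed

lemma disjoint_translates_tree_rays: "disjoint_translates (tree_rays rt)"
  using tree_rays_disjoint unfolding disjoint_family_on_def by blast

lemma translates_tree_rays: "(\<Union>h\<in>stab. bdry_act h ` tree_rays rt) = \<partial>\<F> - inf_exits rt"
proof (intro equalityI subsetI)
  fix \<omega> assume "\<omega> \<in> (\<Union>h\<in>stab. bdry_act h ` tree_rays rt)"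
  then obtain h \<delta> where h: "h \<in> stab" "\<delta> \<in> tree_rays rt" "\<omega> = bdry_act h \<delta>" by blast
  then have "\<delta> \<in> \<partial>\<F>" "\<delta> \<notin> inf_exits rt" by (auto simp: tree_rays_def inf_exits_def frequently_def)
  then show "\<omega> \<in> \<partial>\<F> - inf_exits rt"
    using h by (auto simp: bdry_act_boundary inf_exits_bdry_act stab_def)
qed (use not_inf_exits_cover in blast)

text \<open>Removing from \<open>B\<close> the points covered by its nontrivial translates leaves a
  set with disjoint translates, which is null by \<open>wandering_null\<close>; this is recurrence.
  The translates of the tree rays fill the dissipative part.\<close>

lemma hopf_inf_exits:
  assumes q: "q > 1"
  shows "hopf_decomposition stab_group bdry_act m (inf_exits rt) (\<partial>\<F> - inf_exits rt)"
proof -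
  let ?A = "inf_exits rt" and ?D = "\<partial>\<F> - inf_exits rt"
  have A: "?A \<subseteq> \<partial>\<F>" by (auto simp: inf_exits_def)
  have inv: "bdry_act h ` ?D = ?D" if "h \<in> stab" for h
  proof -
    have "bdry_act h ` \<partial>\<F> = \<partial>\<F>" by (auto simp: bdry_act_image[OF order_refl] bdry_act_boundary)
    then show ?thesis
      using inj_on_image_set_diff[OF inj_on_bdry_act, of "\<partial>\<F>" ?A h] A bdry_act_inf_exits[OF that] by simp
  qed
  have "recurrent_set stab_group bdry_act (restrict_space m ?A) B"
    if B: "B \<in> sets (restrict_space m ?A)" for B
  proof -
    have B': "B \<in> sets m" "B \<subseteq> ?A" using B by (auto simp: sets_restrict_space_iff)
    define R where "R = (\<Union>g\<in>stab - {[]}. bdry_act g ` B)"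
    have R: "R \<in> sets m" unfolding R_def using B' by (intro sets.countable_UN') auto
    have "disjoint_translates (B - R)"
      unfolding disjoint_family_on_def
    proof (intro ballI impI)
      fix g h assume gh: "g \<in> stab" "h \<in> stab" "g \<noteq> h"
      have False if w: "w \<in> B - R" "w' \<in> B - R" "bdry_act g w = bdry_act h w'" for w w'
      proof -
        have b: "w \<in> \<partial>\<F>" "w' \<in> \<partial>\<F>" using w B'(2) A by auto
        let ?k = "reduce (inv_word g @ h)"
        have "w = bdry_act ?k w'"
          using bdry_act_inv_word(1)[OF b(1), of g] b w(3) by (simp add: bdry_act_reduce bdry_act_append)
        moreover have "?k \<in> stab - {[]}"
          using gh stab_inv stab_mult by (auto simp: reduce_eq_iff stab_def reduce_reduced)
        ultimately have "w \<in> R" using w(2) by (auto simp: R_def)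
        then show False using w(1) by blast
      qed
      then show "bdry_act g ` (B - R) \<inter> bdry_act h ` (B - R) = {}" by blast
    qed
    then have "emeasure m (B - R) = 0" using B' R q by (intro wandering_null) auto
    then have "B - R \<in> null_sets m" using B' R by auto
    then have "AE \<omega> in m. \<omega> \<notin> B - R" by (rule AE_not_in)
    then have "AE \<omega> in m. \<omega> \<in> ?A \<longrightarrow> \<omega> \<in> B \<longrightarrow> \<omega> \<in> R" by (auto elim: eventually_mono)
    then show ?thesis
      using B by (simp add: recurrent_set_def stab_group_simps AE_restrict_space_iff R_def free_group_def)
  qed
  then have "conservative_action stab_group bdry_act (restrict_space m ?A)"
    by (simp add: conservative_action_def)
  moreover have "completely_dissipative_action stab_group bdry_act (restrict_space m ?D)"
    unfolding completely_dissipative_action_def wandering_set_def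
  proof (intro exI[of _ "tree_rays rt"] conjI)
    have "tree_rays rt \<subseteq> ?D" using translates_tree_rays stab_Nil by force
    then show "tree_rays rt \<in> sets (restrict_space m ?D)" by (simp add: sets_restrict_space_iff)
    show "AE \<omega> in restrict_space m ?D. \<omega> \<in> (\<Union>g\<in>carrier stab_group. bdry_act g ` tree_rays rt)"
      using translates_tree_rays by (auto simp: AE_restrict_space_iff)
  qed (use disjoint_translates_tree_rays in simp)
  ultimately show ?thesis
    using A inv bdry_act_inf_exits
    by (auto simp: hopf_decomposition_def invariant_set_def space_eq)
qed

text \<open>A wandering set meets a conservative part in a null set. This is applied to the
  wandering set generating \<open>D\<close> against \<open>inf_exits rt\<close>, and to the tree
  rays against \<open>C\<close>.\<close>

lemma conservative_part_AE_eq: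
  assumes q: "q > 1" and "is_conservative_part stab_group bdry_act m C"
  shows "AE \<omega> in m. \<omega> \<in> inf_exits rt \<longleftrightarrow> \<omega> \<in> C"
proof -
  obtain D where D: "hopf_decomposition stab_group bdry_act m C D"
    using assms(2) by (auto simp: is_conservative_part_def)
  then have C: "C \<in> sets m" "conservative_action stab_group bdry_act (restrict_space m C)"
    and D': "D \<in> sets m" "C \<inter> D = {}" "C \<union> D = \<partial>\<F>"
    and "completely_dissipative_action stab_group bdry_act (restrict_space m D)"
    by (auto simp: hopf_decomposition_def space_eq)
  then obtain B where B: "B \<in> sets m" "disjoint_translates B"
    and AE: "AE \<omega> in m. \<omega> \<in> D \<longrightarrow> \<omega> \<in> (\<Union>g\<in>stab. bdry_act g ` B)"
    by (auto simp: completely_dissipative_action_def wandering_set_def sets_restrict_space_iff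
        AE_restrict_space_iff)
  have B': "B \<subseteq> \<partial>\<F>" using sets_subset[OF B(1)] .
  have "(\<Union>g\<in>stab. bdry_act g ` B \<inter> inf_exits rt) \<in> null_sets m"
  proof (rule null_sets_UN')
    fix g assume g: "g \<in> stab"
    have "disjoint_translates (bdry_act g ` B \<inter> inf_exits rt)"
      using disjoint_translates_image[OF B(2) B' g] by (rule disjoint_translates_subset) auto
    then have "emeasure m (bdry_act g ` B \<inter> inf_exits rt) = 0"
      using B by (intro wandering_null[OF q]) auto
    then show "bdry_act g ` B \<inter> inf_exits rt \<in> null_sets m" using B by auto
  qed simp
  then have 1: "AE \<omega> in m. \<omega> \<notin> (\<Union>g\<in>stab. bdry_act g ` B \<inter> inf_exits rt)" by (rule AE_not_in)
  have "(\<Union>g\<in>stab. bdry_act g ` tree_rays rt \<inter> C) \<in> null_sets m"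
  proof (rule null_sets_UN')
    fix g assume g: "g \<in> stab"
    have "tree_rays rt \<subseteq> \<partial>\<F>" by (auto simp: tree_rays_def)
    then have "disjoint_translates (bdry_act g ` tree_rays rt \<inter> C)"
      by (intro disjoint_translates_subset[OF disjoint_translates_image[OF disjoint_translates_tree_rays _ g]])
        auto
    then show "bdry_act g ` tree_rays rt \<inter> C \<in> null_sets m"
      using C by (intro wandering_null_conservative[OF C]) auto
  qed simp
  then have 2: "AE \<omega> in m. \<omega> \<notin> (\<Union>g\<in>stab. bdry_act g ` tree_rays rt \<inter> C)" by (rule AE_not_in)
  show ?thesis using AE 1 2 AE_space
  proof eventually_elim
    case (elim \<omega>)
    have "\<omega> \<in> \<partial>\<F>" using elim(4) by (simp add: space_eq)
    have "\<omega> \<in> C" if "\<omega> \<in> inf_exits rt"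
    proof (rule ccontr)
      assume "\<omega> \<notin> C"
      then have "\<omega> \<in> D" using D' \<open>\<omega> \<in> \<partial>\<F>\<close> by blast
      then show False using elim(1,2) that by blast
    qed
    moreover have "\<omega> \<in> inf_exits rt" if "\<omega> \<in> C"
    proof (rule ccontr)
      assume "\<omega> \<notin> inf_exits rt"
      then have "\<omega> \<in> (\<Union>h\<in>stab. bdry_act h ` tree_rays rt)"
        using translates_tree_rays \<open>\<omega> \<in> \<partial>\<F>\<close> by simp
      then show False using elim(3) that by blast
    qed
    ultimately show ?case by blast
  qed
qed

end

section \<open>Schreier graphs\<close>

primrec arcs_of :: "('v \<Rightarrow> 'a letter \<Rightarrow> 'v) \<Rightarrow> 'v \<Rightarrow> 'a letter list \<Rightarrow> ('v \<times> 'a letter) list" where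
  "arcs_of st x [] = []"
| "arcs_of st x (a # w) = (x, a) # arcs_of st (st x a) w"

lemma map_snd_arcs_of [simp]: "map snd (arcs_of st x w) = w"
  by (induction w arbitrary: x) auto

lemma length_arcs_of [simp]: "length (arcs_of st x w) = length w"
  by (induction w arbitrary: x) auto

text \<open>Serves both the Schreier graph and its spanning tree, translating walks given as lists
  of arcs into words of labels.\<close>

locale labelled_digraph =
  fixes G :: "('v, 'v \<times> 'a letter) pre_digraph" and st :: "'v \<Rightarrow> 'a letter \<Rightarrow> 'v"
  assumes tail_eq: "tail G = fst" and head_eq: "head G = (\<lambda>(x, a). st x a)"
    and wf: "wf_digraph G"
begin

sublocale wf_digraph G by (rule wf)

lemma awalk_iff:
  "awalk x p y \<longleftrightarrow> x \<in> verts G \<and> p = arcs_of st x (map snd p) \<and>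
     walk_in st (arcs G) x (map snd p) \<and> foldl st x (map snd p) = y"
proof -
  have "set p \<subseteq> arcs G \<and> cas x p y \<longleftrightarrow> p = arcs_of st x (map snd p) \<and>
     walk_in st (arcs G) x (map snd p) \<and> foldl st x (map snd p) = y"
  proof (induction p arbitrary: x)
    case (Cons e p)
    show ?case using Cons.IH[of "st (fst e) (snd e)"] by (cases e) (auto simp: tail_eq head_eq)
  qed auto
  then show ?thesis by (auto simp: awalk_def)
qed

lemma awalk_arcs_of:
  "x \<in> verts G \<Longrightarrow> walk_in st (arcs G) x w \<Longrightarrow> awalk x (arcs_of st x w) (foldl st x w)"
  by (simp add: awalk_iff)

lemma awalk_verts_arcs_of:
  "awalk_verts x (arcs_of st x w) = map (\<lambda>i. foldl st x (take i w)) [0..<Suc (length w)]"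
proof (induction w arbitrary: x)
  case (Cons a w)
  have "[0..<Suc (length (a # w))] = 0 # map Suc [0..<Suc (length w)]"
    by (metis length_Cons map_Suc_upt upt_conv_Cons zero_less_Suc)
  then show ?case using Cons by (simp add: tail_eq head_eq comp_def del: upt_Suc)
qed (simp add: tail_eq)

lemma awalk_cost_length: "awalk_cost (\<lambda>_. 1) p = real (length p)"
  by (induction p) auto

lemma graph_dist_le:
  assumes "x \<in> verts G" "walk_in st (arcs G) x w"
  shows "graph_dist G x (foldl st x w) \<le> ereal (length w)"
  using min_cost_le_walk_cost[OF awalk_arcs_of[OF assms], of "\<lambda>_. 1"]
  by (simp add: graph_dist_def awalk_cost_length)

lemma graph_dist_attained:
  assumes "graph_dist G x y < \<infinity>"
  obtains w where "walk_in st (arcs G) x w" "foldl st x w = y" "ereal (length w) \<le> graph_dist G x y"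
proof -
  \<comment> \<open>An infimum over no walks would be infinite. Once a walk exists, a shortest one
    attains the distance, as lengths are natural numbers.\<close>
  have "{p. awalk x p y} \<noteq> {}"
  proof
    assume "{p. awalk x p y} = {}"
    then have "graph_dist G x y = \<infinity>" by (simp only: graph_dist_def \<mu>_def) (simp add: top_ereal_def)
    then show False using assms by simp
  qed
  then obtain p where p: "awalk x p y" "\<And>p'. awalk x p' y \<Longrightarrow> length p \<le> length p'"
    using ex_has_least_nat[of "\<lambda>p. awalk x p y" _ length] by blast
  have "ereal (length p) \<le> graph_dist G x y"
    unfolding graph_dist_def \<mu>_def using p(2) by (intro INF_greatest) (auto simp: awalk_cost_length)
  then show ?thesis using that[of "map snd p"] p(1) by (simp add: awalk_iff)
qed

text \<open>If no vertex recurs, a nonempty closed walk is a cycle, hence a backtracking pair by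
  \<open>cyc\<close>, whose labels are not reduced. Otherwise the segment between two visits of a
  vertex is a shorter closed walk, and the induction applies.\<close>

lemma reduced_closed_walk_Nil:
  assumes step: "\<And>x a. x \<in> verts G \<Longrightarrow> st x a \<in> verts G"
    and cyc: "\<And>p. cycle p \<Longrightarrow> \<exists>e. p = [e, (st (fst e) (snd e), inv_letter (snd e))]"
    and w: "x \<in> verts G" "walk_in st (arcs G) x w" "reduced w" "foldl st x w = x"
  shows "w = []"
  using w
proof (induction w arbitrary: x rule: length_induct)
  case (1 w)
  show ?case
  proof (rule ccontr)
    assume "w \<noteq> []"
    let ?p = "arcs_of st x w"
    show False
    proof (cases "distinct (tl (awalk_verts x ?p))")
      case True
      have "awalk x ?p x" using awalk_arcs_of[of x w] 1 by simp
      moreover have "?p \<noteq> []" using \<open>w \<noteq> []\<close> by (cases w) auto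
      ultimately have "cycle ?p" using True by (auto simp: cycle_def)
      then obtain e where "?p = [e, (st (fst e) (snd e), inv_letter (snd e))]" using cyc by blast
      then have "map snd ?p = [snd e, inv_letter (snd e)]" by simp
      then show False using \<open>reduced w\<close> by (simp add: reduced_Cons)
    next
      case False
      define f where "f = (\<lambda>i. foldl st x (take i w))"
      have "tl (awalk_verts x ?p) = map f [1..<Suc (length w)]"
        unfolding awalk_verts_arcs_of f_def map_tl[symmetric] by (simp del: upt_Suc add: tl_upt)
      \<comment> \<open>The start vertex is dropped from the list, so \<open>1 \<le> i\<close>,
        which makes the segment strictly shorter than \<open>w\<close>.\<close>
      then obtain i j where ij: "1 \<le> i" "i < j" "j \<le> length w" "f i = f j"
        using False
        by (auto simp: distinct_map inj_on_def less_Suc_eq_le simp del: upt_Suc) (metis linorder_neq_iff)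
      define u where "u = drop i (take j w)"
      have ti: "take i w @ u = take j w" using append_take_drop_id[of i "take j w"] ij by (simp add: u_def min_def)
      then have w: "take i w @ u @ drop j w = w" by (metis append.assoc append_take_drop_id)
      have V: "f i \<in> verts G"
      proof -
        have "foldl st x v \<in> verts G" for v
          using \<open>x \<in> verts G\<close> by (induction v rule: rev_induct) (auto simp: step)
        then show ?thesis by (simp add: f_def)
      qed
      have "walk_in st (arcs G) x (take i w @ u @ drop j w)" "reduced (take i w @ u @ drop j w)"
        using 1(3,4) unfolding w by auto
      then have u: "walk_in st (arcs G) (f i) u" "reduced u"
        by (auto simp: f_def walk_in_append reduced_append)
      have "foldl st (f i) u = f j" using arg_cong[OF ti, of "foldl st x"] by (simp add: f_def)
      then have "foldl st (f i) u = f i" using ij by simp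
      moreover have "length u < length w" using ij by (simp add: u_def)
      ultimately have "u = []" using 1(1) u V by blast
      then show False using ij by (auto simp: u_def)
    qed
  qed
qed

text \<open>Two cancelling labels would bring the path back to the vertex visited two steps
  before.\<close>

lemma apath_reduced:
  assumes "apath x p y" and st_inv: "\<And>z a. z \<in> verts G \<Longrightarrow> st (st z a) (inv_letter a) = z"
    and step: "\<And>x a. x \<in> verts G \<Longrightarrow> st x a \<in> verts G"
  shows "reduced (map snd p)"
  unfolding reduced_nth
proof (intro allI impI notI)
  define w where "w = map snd p"
  define f where "f = (\<lambda>i. foldl st x (take i w))"
  have x: "x \<in> verts G" and p: "p = arcs_of st x w" and d: "distinct (awalk_verts x p)"
    using assms(1) by (auto simp: apath_def awalk_iff w_def)
  fix i assume i: "Suc i < length (map snd p)" and eq: "map snd p ! Suc i = inv_letter (map snd p ! i)"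
  have V: "f k \<in> verts G" for k
  proof -
    have "foldl st x v \<in> verts G" for v using x by (induction v rule: rev_induct) (auto simp: step)
    then show ?thesis by (simp add: f_def)
  qed
  have "f (Suc (Suc i)) = f i"
    using i eq V[of i] st_inv[of "f i" "w ! i"] unfolding w_def[symmetric]
    by (simp add: f_def take_Suc_conv_app_nth)
  moreover have "inj_on f {0..<Suc (length w)}"
    using d unfolding p awalk_verts_arcs_of f_def by (simp add: distinct_map del: upt_Suc)
  ultimately have "Suc (Suc i) = i" using i by (auto simp: inj_on_def w_def)
  then show False by simp
qed

end

text \<open>A reduced tree walk cannot repeat a vertex, since the segment in between would
  contradict \<open>acyclic\<close>. Conversely, a path without repetitions is reduced, so
  uniqueness of reduced tree walks identifies the two notions.\<close>

lemma (in labelled_digraph) tree_path_eq_pth: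
  assumes "rooted_tree (verts G) st rt (arcs G)" and V: "x \<in> verts G" "y \<in> verts G"
  shows "map snd (tree_path G x y) = rooted_tree.pth st (arcs G) x y"
proof -
  interpret rooted_tree "verts G" st rt "arcs G" by fact
  let ?w = "pth x y"
  have "apath x (arcs_of st x ?w) y"
  proof -
    define f where "f = (\<lambda>i. mv x (take i ?w))"
    have "f i \<noteq> f j" if "i < j" "j \<le> length ?w" for i j
    proof
      assume eq: "f i = f j"
      define u where "u = drop i (take j ?w)"
      have ti: "take i ?w @ u = take j ?w"
        using append_take_drop_id[of i "take j ?w"] that by (simp add: u_def min_def)
      then have w: "take i ?w @ u @ drop j ?w = ?w" by (metis append.assoc append_take_drop_id)
      have "tp x (take i ?w @ u @ drop j ?w)" "reduced (take i ?w @ u @ drop j ?w)"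
        unfolding w using V by (simp_all add: pth)
      then have "tp (f i) u" "reduced u"
        by (auto simp: f_def walk_in_append reduced_append)
      moreover have "mv (f i) u = f i" using arg_cong[OF ti, of "mv x"] by (simp add: f_def eq[unfolded f_def])
      ultimately have "u = []" using V by (intro acyclic[of "f i"]) (auto simp: f_def)
      then show False using that by (auto simp: u_def)
    qed
    then have "inj_on f {0..<Suc (length ?w)}"
      by (auto simp: inj_on_def less_Suc_eq_le) (metis linorder_neq_iff)
    then have "distinct (awalk_verts x (arcs_of st x ?w))"
      unfolding awalk_verts_arcs_of by (simp add: f_def distinct_map del: upt_Suc)
    then show ?thesis using awalk_arcs_of[of x ?w] V by (simp add: apath_def pth)
  qed
  moreover have "p = arcs_of st x ?w" if p: "apath x p y" for p
  proof -
    have "awalk x p y" using p by (simp add: apath_def)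
    then have w: "p = arcs_of st x (map snd p)" "tp x (map snd p)" "mv x (map snd p) = y"
      unfolding awalk_iff by blast+
    have "pth x y = map snd p"
      using apath_reduced[OF p st_inv st_closed] w V by (intro pth_eqI) auto
    then show ?thesis using w(1) by metis
  qed
  ultimately have "tree_path G x y = arcs_of st x ?w"
    unfolding tree_path_def by (rule the_equality)
  then show ?thesis by simp
qed

locale schreier_tree =
  fixes H :: "'a letter list set" and T :: "('a coset, 'a arc) pre_digraph"
  assumes subgroup: "subgroup H \<F>" and tree: "geodesic_spanning_tree H T"
begin

abbreviation "X \<equiv> schreier_graph H"
abbreviation "V \<equiv> rcosets\<^bsub>\<F>\<^esub> H"

definition cmul :: "'a coset \<Rightarrow> 'a letter \<Rightarrow> 'a coset" where
  "cmul x a = x #>\<^bsub>\<F>\<^esub> [a]"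

interpretation F: group "\<F> :: 'a letter list monoid" by (rule group_free_group)

lemma coset_subset: "x \<in> V \<Longrightarrow> x \<subseteq> carrier \<F>"
  using F.rcosets_part_G[OF subgroup] by blast

lemma cmul_closed: "x \<in> V \<Longrightarrow> cmul x a \<in> V"
proof -
  assume "x \<in> V"
  then obtain g where g: "g \<in> carrier \<F>" "x = H #>\<^bsub>\<F>\<^esub> g" by (auto simp: RCOSETS_def)
  have a: "[a] \<in> carrier \<F>" by (simp add: carrier_free_group)
  have "cmul x a = H #>\<^bsub>\<F>\<^esub> (g \<otimes>\<^bsub>\<F>\<^esub> [a])"
    unfolding cmul_def g(2) by (rule F.coset_mult_assoc[OF subgroup.subset[OF subgroup] g(1) a])
  then show ?thesis using g(1) a F.m_closed by (auto simp: RCOSETS_def)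
qed

lemma foldl_cmul: "x \<in> V \<Longrightarrow> foldl cmul x w = x #>\<^bsub>\<F>\<^esub> reduce w"
proof (induction w arbitrary: x)
  case Nil
  then show ?case using F.coset_mult_one[OF coset_subset] by (simp add: one_free_group)
next
  case (Cons a w)
  have "cmul x a #>\<^bsub>\<F>\<^esub> reduce w = x #>\<^bsub>\<F>\<^esub> ([a] \<otimes>\<^bsub>\<F>\<^esub> reduce w)"
    unfolding cmul_def using Cons.prems
    by (intro F.coset_mult_assoc coset_subset) (auto simp: carrier_free_group)
  also have "[a] \<otimes>\<^bsub>\<F>\<^esub> reduce w = reduce (a # w)"
    using reduce_append_reduce(2)[of "[a]" w] by (simp add: mult_free_group)
  finally show ?case using Cons cmul_closed by simp
qed

lemma cmul_inv: "x \<in> V \<Longrightarrow> cmul (cmul x a) (inv_letter a) = x"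
  using foldl_cmul[of x "[a, inv_letter a]"] reduce_inv_word(2)[of "[a]"] foldl_cmul[of x "[]"] by simp

lemma H_coset: "H \<in> V"
proof -
  have "H #>\<^bsub>\<F>\<^esub> \<one>\<^bsub>\<F>\<^esub> = H" by (rule F.coset_mult_one[OF subgroup.subset[OF subgroup]])
  then show ?thesis using F.one_closed unfolding RCOSETS_def by blast
qed

lemma stabilizer_eq: "{g. reduced g \<and> foldl cmul H g = H} = H"
proof -
  have "H #>\<^bsub>\<F>\<^esub> g = H \<longleftrightarrow> g \<in> H" if "reduced g" for g
    using F.coset_join1[OF _ _ subgroup] F.coset_join2[OF _ subgroup] that
    by (auto simp: carrier_free_group)
  moreover have "reduced g" if "g \<in> H" for g
    using subgroup.subset[OF subgroup] that by (auto simp: carrier_free_group)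
  ultimately show ?thesis using H_coset by (auto simp: foldl_cmul reduce_reduced)
qed

lemma schreier_graph_simps:
  "verts X = V" "arcs X = V \<times> UNIV" "tail X = fst" "head X = (\<lambda>(x, a). cmul x a)"
  by (simp_all add: schreier_graph_def cmul_def)

lemma T_simps: "verts T = V" "arcs T \<subseteq> V \<times> UNIV" "tail T = fst" "head T = (\<lambda>(x, a). cmul x a)"
  and wf: "wf_digraph T" "wf_digraph X"
  using tree schreier_graph_simps
  by (auto simp: geodesic_spanning_tree_def spanning_def subgraph_def compatible_def)

lemma arc_rev_eq: "arc_rev e = (cmul (fst e) (snd e), inv_letter (snd e))"
  by (simp add: arc_rev_def cmul_def case_prod_beta)

sublocale GX: labelled_digraph X cmul
  by unfold_locales (simp_all add: schreier_graph_simps wf_digraph.tail_in_verts wf_digraph.head_in_verts wf(2)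
      mem_Times_iff case_prod_beta cmul_closed)

sublocale GT: labelled_digraph T cmul
  by (intro labelled_digraph.intro T_simps wf)

lemma walk_in_X: "x \<in> V \<Longrightarrow> walk_in cmul (V \<times> UNIV) x w"
  by (induction w arbitrary: x) (auto simp: cmul_closed)

text \<open>\<open>acyclic\<close> comes from the restriction on cycles in
  \<open>undirected_tree\<close>, and \<open>geodesic\<close> from the equality of distances in tree
  and graph.\<close>

sublocale rooted_tree V cmul H "arcs T"
proof
  show "H \<in> V" by (rule H_coset)
  show "cmul x a \<in> V" if "x \<in> V" for x a using that by (rule cmul_closed)
  show "cmul (cmul x a) (inv_letter a) = x" if "x \<in> V" for x a using that by (rule cmul_inv)
  have ut: "undirected_tree T arc_rev" using tree by (simp add: geodesic_spanning_tree_def)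
  show "(cmul x a, inv_letter a) \<in> arcs T" if "(x, a) \<in> arcs T" for x a
  proof -
    have "arc_rev (x, a) \<in> arcs T" using ut that by (simp add: undirected_tree_def)
    then show ?thesis by (simp add: arc_rev_eq)
  qed
  show "w = []" if "x \<in> V" "walk_in cmul (arcs T) x w" "reduced w" "foldl cmul x w = x" for x w
  proof (rule GT.reduced_closed_walk_Nil)
    fix p assume "GT.cycle p"
    then obtain e where "p = [e, arc_rev e]" using ut by (auto simp: undirected_tree_def)
    then show "\<exists>e. p = [e, (cmul (fst e) (snd e), inv_letter (snd e))]" by (auto simp: arc_rev_eq)
  qed (use that in \<open>auto simp: T_simps cmul_closed\<close>)
  show "\<exists>w. walk_in cmul (arcs T) H w \<and> foldl cmul H w = x \<and>
      (\<forall>v. foldl cmul H v = x \<longrightarrow> length w \<le> length v)" if x: "x \<in> V" for x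
  proof -
    have dist: "graph_dist T H x = graph_dist X H x"
      using tree x by (simp add: geodesic_spanning_tree_def schreier_graph_simps)
    \<comment> \<open>Every word labels a walk in the full graph, so its length bounds the common
      distance.\<close>
    have le: "graph_dist T H x \<le> ereal (length v)" if "foldl cmul H v = x" for v
      using GX.graph_dist_le[of H v] that H_coset by (simp add: dist schreier_graph_simps walk_in_X)
    obtain g where "g \<in> carrier \<F>" "x = H #>\<^bsub>\<F>\<^esub> g" using x by (auto simp: RCOSETS_def)
    then have "foldl cmul H g = x" using H_coset by (simp add: foldl_cmul carrier_free_group reduce_reduced)
    then have "graph_dist T H x \<le> ereal (length g)" by (rule le)
    then have "graph_dist T H x < \<infinity>" by (rule le_less_trans) simp
    then obtain w where "walk_in cmul (arcs T) H w" "foldl cmul H w = x"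
      "ereal (length w) \<le> graph_dist T H x"
      using GT.graph_dist_attained by blast
    then show ?thesis using le by (metis ereal_less_eq(3) of_nat_le_iff order_trans)
  qed
qed

lemma stab_eq: "stab = H"
  using stabilizer_eq by (simp add: stab_def)

text \<open>The tree paths agree by \<open>tree_path_eq_pth\<close>, and the reduction in
  \<open>edge_element\<close> changes nothing by \<open>reduced_gen\<close>.\<close>

lemma sym_generators_eq: "sym_generators H T = gen ` ext"
proof -
  have tp: "map snd (tree_path T x y) = pth x y" if "x \<in> V" "y \<in> V" for x y
    using GT.tree_path_eq_pth[of H x y] rooted_tree_axioms that by (simp add: T_simps)
  have ext: "arcs X - arcs T = ext" by (simp add: ext_def schreier_graph_simps)
  have "edge_element H T e = gen e" if "e \<in> ext" for e
  proof -
    have "fst e \<in> V" using that by (auto simp: ext_def)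
    then have "edge_element H T e = reduce (gen e)"
      using H_coset
      by (simp add: edge_element_def gen_def schreier_graph_simps tp cmul_closed case_prod_beta)
    then show ?thesis using reduced_gen[OF that] by (simp add: reduce_reduced)
  qed
  then show ?thesis unfolding sym_generators_def ext by (rule image_cong[OF refl])
qed

lemma schreier_limit_set_eq: "schreier_limit_set H T = inf_exits H"
  by (simp add: schreier_limit_set_def subgroup_boundary_def sym_generators_eq limit_set_eq)

end

theorem theorem2p12:
  fixes H :: "'a::finite letter list set"
    and T :: "('a coset, 'a arc) pre_digraph"
    and m :: "'a letter stream measure"
  assumes "CARD('a) \<ge> 2"
    and "subgroup H \<F>"
    and "geodesic_spanning_tree H T"
    and "is_uniform_boundary_measure m"
  shows "(\<exists>C. is_conservative_part (\<F>\<lparr>carrier := H\<rparr>) bdry_act m C) \<and>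
         (\<forall>C. is_conservative_part (\<F>\<lparr>carrier := H\<rparr>) bdry_act m C \<longrightarrow>
            (AE \<omega> in m. \<omega> \<in> schreier_limit_set H T \<longleftrightarrow> \<omega> \<in> C))"
proof -
  interpret schreier_tree H T by (rule schreier_tree.intro) (use assms in auto)
  interpret boundary_tree m V cmul H "arcs T"
    using assms(4) by unfold_locales
  \<comment> \<open>Having at least two generators enters here: then \<open>q\<close> is at least
    \<open>3\<close>, and the expansion factors \<open>q ^ k\<close> are unbounded.\<close>
  have q: "q > 1" using assms(1) by (simp add: q_def)
  show ?thesis
    using hopf_inf_exits[OF q] conservative_part_AE_eq[OF q]
    by (auto simp: is_conservative_part_def stab_eq schreier_limit_set_eq)
qed

end
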